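(* For each $n$ let parameters $k,\lambda,M,M',x,x'$ (all allowed to depend on $n$) be given, where $x\in[0,1]^M$, $x'\in[0,1]^{M'}$, $\sum_{\ell=1}^M x_\ell=\sum_{\ell=1}^{M'}x'_\ell=1$, and let $\mathbb{P}=\mathbb{P}_{\rm Gaussian}(n,k,\lambda,M,x)$ and $\mathbb{Q}=\mathbb{P}_{\rm Gaussian}(n,k,\lambda,M',x')$. Assume that $M\min_\ell x_\ell\ge C$ and $M'\min_\ell x'_\ell\ge C$ for some constant $C>0$ (independent of $n$). Write $\widetilde M=|M-M'|$ and $\widehat M=\max\{M,M'\}$. Then, as $n\to\infty$: (1) If $D=D_n$ satisfies $D^5\widehat M^2\lambda^2\left(\frac{k^2}{n}\vee 1\right)=o(1)$, then no degree-$D$ test weakly separates $\mathbb{P}$ and $\mathbb{Q}$. (2) If $\widetilde M^2\lambda^2k^2/n=\omega(1)$ and $\widetilde M^2k/\widehat M^2=\omega(1)$, then there exists a degree-1 test that strongly separates $\mathbb{P}$ and $\mathbb{Q}$.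
   Context: Notation: $[n]=\{1,\dots,n\}$, $a\vee b=\max\{a,b\}$. Additive Gaussian model. Given the number of vertices $n$, total community size $k$ (with $0<k\le n$), signal strength $\lambda>0$, number of communities $M\in\{1,2,\dots\}$ and community proportions $x\in[0,1]^M$ with $\sum_{\ell}x_\ell=1$ (and all $x_\ell>0$), the distribution $\mathbb{P}_{\rm Gaussian}(n,k,\lambda,M,x)$ of the observation $Y$ is defined as follows. Independently for each $i\in[n]$, a label $\sigma_i$ is sampled with $\sigma_i=\ell$ with probability $x_\ell k/n$ for each $\ell\in[M]$ and $\sigma_i=\star$ (no community) with probability $1-k/n$. Given the labels, independently for $i\le j$, $Y_{ij}\sim\mathcal{N}(\lambda/x_\ell,1)$ if $\sigma_i=\sigma_j=\ell$ for some $\ell\in[M]$, and $Y_{ij}\sim\mathcal{N}(0,1)$ otherwise; for $i>j$, $Y_{ij}=Y_{ji}$. Thus the observation is viewed as a vector in $\mathbb{R}^N$, $N=n(n+1)/2$. Tests and separation. For sequences of distributions $\mathbb{P}=\mathbb{P}_n$, $\mathbb{Q}=\mathbb{Q}_n$ on $\mathbb{R}^{N_n}$, a degree-$D$ test is a sequence of polynomials $f=f_n:\mathbb{R}^{N_n}\to\mathbb{R}$ of degree at most $D=D_n$. It strongly separates $\mathbb{P}$ and $\mathbb{Q}$ if, as $n\to\infty$, $\sqrt{\max\{\mathrm{Var}_{\mathbb{Q}}[f],\mathrm{Var}_{\mathbb{P}}[f]\}}=o\left(|\mathbb{E}_{\mathbb{P}}[f]-\mathbb{E}_{\mathbb{Q}}[f]|\right)$,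 and weakly separates them if the same holds with $O(\cdot)$ in place of $o(\cdot)$; in both cases it is understood that $\mathbb{E}_{\mathbb{P}}[f]\ne\mathbb{E}_{\mathbb{Q}}[f]$ for all sufficiently large $n$. *)

theory Defs
  imports "HOL-Probability.Probability" "HOL-Library.Landau_Symbols"
begin

definition valid_params :: "nat \<Rightarrow> real \<Rightarrow> real \<Rightarrow> nat \<Rightarrow> (nat \<Rightarrow> real) \<Rightarrow> bool" where
  "valid_params n k lam M x \<longleftrightarrow>
     0 < k \<and> k \<le> real n \<and> 0 < lam \<and> 1 \<le> M \<and>
     (\<forall>l\<in>{1..M}. 0 < x l \<and> x l \<le> 1) \<and> (\<Sum>l\<in>{1..M}. x l) = 1"

text \<open>A label is \<open>Some l\<close> for membership in community \<open>l\<close>, and \<open>None\<close> for \<open>\<star>\<close>.\<close>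

definition label_pmf :: "nat \<Rightarrow> real \<Rightarrow> nat \<Rightarrow> (nat \<Rightarrow> real) \<Rightarrow> nat option pmf" where
  "label_pmf n k M x = embed_pmf (\<lambda>s. case s of
       None \<Rightarrow> 1 - k / real n
     | Some l \<Rightarrow> if l \<in> {1..M} then x l * k / real n else 0)"

definition signal :: "real \<Rightarrow> (nat \<Rightarrow> real) \<Rightarrow> (nat \<Rightarrow> nat option) \<Rightarrow> nat \<times> nat \<Rightarrow> real" where
  "signal lam x \<sigma> = (\<lambda>(i, j). case \<sigma> i of
       None \<Rightarrow> 0
     | Some l \<Rightarrow> if \<sigma> j = Some l then lam / x l else 0)"

text \<open>The observation is symmetric, so only the entries on and above the diagonal are kept;
  they are the \<open>n (n + 1) / 2\<close> coordinates of the observation space.\<close>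

definition entries :: "nat \<Rightarrow> (nat \<times> nat) set" where
  "entries n = {(i, j). 1 \<le> i \<and> i \<le> j \<and> j \<le> n}"

definition noisy_entries ::
    "nat \<Rightarrow> real \<Rightarrow> (nat \<Rightarrow> real) \<Rightarrow> (nat \<Rightarrow> nat option) \<Rightarrow> (nat \<times> nat \<Rightarrow> real) measure" where
  "noisy_entries n lam x \<sigma> =
     (\<Pi>\<^sub>M e\<in>entries n. density lborel (normal_density (signal lam x \<sigma> e) 1))"

definition gaussian_model ::
    "nat \<Rightarrow> real \<Rightarrow> real \<Rightarrow> nat \<Rightarrow> (nat \<Rightarrow> real) \<Rightarrow> (nat \<times> nat \<Rightarrow> real) measure" where
  "gaussian_model n k lam M x =
     measure_pmf (Pi_pmf {1..n} None (\<lambda>_. label_pmf n k M x)) \<bind> noisy_entries n lam x"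

text \<open>\<open>A\<close> is a finite set of exponent vectors; only their values on \<open>E\<close> matter.\<close>

definition poly_fun_on :: "'i set \<Rightarrow> nat \<Rightarrow> (('i \<Rightarrow> real) \<Rightarrow> real) \<Rightarrow> bool" where
  "poly_fun_on E D f \<longleftrightarrow>
     (\<exists>A c. finite A \<and> (\<forall>\<alpha>\<in>A. (\<Sum>e\<in>E. \<alpha> e) \<le> D) \<and>
        (\<forall>y. f y = (\<Sum>\<alpha>\<in>A. c \<alpha> * (\<Prod>e\<in>E. y e ^ \<alpha> e))))"

definition degree_test :: "(nat \<Rightarrow> nat) \<Rightarrow> (nat \<Rightarrow> (nat \<times> nat \<Rightarrow> real) \<Rightarrow> real) \<Rightarrow> bool" where
  "degree_test D f \<longleftrightarrow> (\<forall>n. poly_fun_on (entries n) (D n) (f n))"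

definition mean_gap :: "'a measure \<Rightarrow> 'a measure \<Rightarrow> ('a \<Rightarrow> real) \<Rightarrow> real" where
  "mean_gap P Q f = \<bar>prob_space.expectation P f - prob_space.expectation Q f\<bar>"

definition max_sd :: "'a measure \<Rightarrow> 'a measure \<Rightarrow> ('a \<Rightarrow> real) \<Rightarrow> real" where
  "max_sd P Q f = sqrt (max (prob_space.variance Q f) (prob_space.variance P f))"

definition strongly_separates ::
    "(nat \<Rightarrow> 'a \<Rightarrow> real) \<Rightarrow> (nat \<Rightarrow> 'a measure) \<Rightarrow> (nat \<Rightarrow> 'a measure) \<Rightarrow> bool" where
  "strongly_separates f P Q \<longleftrightarrow>
     (\<forall>\<^sub>F n in sequentially. prob_space.expectation (P n) (f n) \<noteq> prob_space.expectation (Q n) (f n)) \<and>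
     (\<lambda>n. max_sd (P n) (Q n) (f n)) \<in> o(\<lambda>n. mean_gap (P n) (Q n) (f n))"

definition weakly_separates ::
    "(nat \<Rightarrow> 'a \<Rightarrow> real) \<Rightarrow> (nat \<Rightarrow> 'a measure) \<Rightarrow> (nat \<Rightarrow> 'a measure) \<Rightarrow> bool" where
  "weakly_separates f P Q \<longleftrightarrow>
     (\<forall>\<^sub>F n in sequentially. prob_space.expectation (P n) (f n) \<noteq> prob_space.expectation (Q n) (f n)) \<and>
     (\<lambda>n. max_sd (P n) (Q n) (f n)) \<in> O(\<lambda>n. mean_gap (P n) (Q n) (f n))"

lemma finite_entries: "finite (entries n)"
  by (rule finite_subset[of _ "{1..n} \<times> {1..n}"]) (auto simp: entries_def)

lemma pmf_label_pmf:
  assumes "valid_params n k lam M x"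
  shows "pmf (label_pmf n k M x) s = (case s of
       None \<Rightarrow> 1 - k / real n
     | Some l \<Rightarrow> if l \<in> {1..M} then x l * k / real n else 0)"
proof -
  define g where "g = (\<lambda>s. case s of
       None \<Rightarrow> 1 - k / real n
     | Some l \<Rightarrow> if l \<in> {1..M} then x l * k / real n else 0)"
  have n: "real n > 0" and k: "0 < k" "k \<le> real n" and x: "\<And>l. l \<in> {1..M} \<Longrightarrow> 0 < x l"
    and s1: "(\<Sum>l\<in>{1..M}. x l) = 1"
    using assms by (auto simp: valid_params_def)
  have nn: "0 \<le> g s" for s
    using n k x by (auto simp: g_def less_imp_le split: option.splits)
  let ?A = "insert None (Some ` {1..M})"
  have "(\<integral>\<^sup>+s. ennreal (g s) \<partial>count_space UNIV) = (\<Sum>s\<in>?A. ennreal (g s))"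
    by (rule nn_integral_count_space') (auto simp: g_def split: option.splits)
  also have "\<dots> = ennreal (\<Sum>s\<in>?A. g s)"
    using nn by (intro sum_ennreal) auto
  also have "(\<Sum>s\<in>?A. g s) = g None + (\<Sum>l\<in>{1..M}. g (Some l))"
    by (subst sum.insert) (auto simp: sum.reindex)
  also have "(\<Sum>l\<in>{1..M}. g (Some l)) = (\<Sum>l\<in>{1..M}. x l) * k / real n"
    by (simp add: g_def sum_distrib_right sum_divide_distrib)
  finally have "(\<integral>\<^sup>+s. ennreal (g s) \<partial>count_space UNIV) = 1"
    using s1 by (simp add: g_def)
  then show ?thesis
    unfolding label_pmf_def g_def[symmetric] using nn by (subst pmf_embed_pmf) (auto simp: g_def)
qed

lemma prob_space_noisy_entries: "prob_space (noisy_entries n lam x \<sigma>)"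
  unfolding noisy_entries_def by (intro prob_space_PiM prob_space_normal_density) simp

lemma sets_noisy_entries [measurable_cong]:
  "sets (noisy_entries n lam x \<sigma>) = sets (\<Pi>\<^sub>M e\<in>entries n. borel)"
  unfolding noisy_entries_def by (intro sets_PiM_cong) auto

lemma noisy_entries_measurable:
  "noisy_entries n lam x \<in>
     measurable (measure_pmf p) (prob_algebra (\<Pi>\<^sub>M e\<in>entries n. borel))"
proof (rule measurable_prob_algebraI)
  have "noisy_entries n lam x \<sigma> \<in> space (subprob_algebra (\<Pi>\<^sub>M e\<in>entries n. borel))" for \<sigma>
    by (simp add: space_subprob_algebra sets_noisy_entries
        prob_space_imp_subprob_space[OF prob_space_noisy_entries])
  then show "noisy_entries n lam x \<in>
      measurable (measure_pmf p) (subprob_algebra (\<Pi>\<^sub>M e\<in>entries n. borel))"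
    by (simp add: Pi_iff)
qed (rule prob_space_noisy_entries)

lemma sets_gaussian_model: "sets (gaussian_model n k lam M x) = sets (\<Pi>\<^sub>M e\<in>entries n. borel)"
  unfolding gaussian_model_def by (intro sets_bind sets_noisy_entries) auto

lemma prob_space_gaussian_model: "prob_space (gaussian_model n k lam M x)"
  unfolding gaussian_model_def
  by (rule measure_pmf.prob_space_bind[OF _ measurable_prob_algebraD[OF noisy_entries_measurable]])
     (simp add: prob_space_noisy_entries)

end

theory Submission
  imports Defs "HOL-Computational_Algebra.Polynomial"
begin

text \<open>
  Write the observation as \<open>Y = X + Z\<close> with signal \<open>X\<close> and Gaussian noise \<open>Z\<close>. If \<open>r\<close> denotes the
  coefficients of the quotient of the exponential generating functions of the moments of \<open>X\<close>
  under \<open>P\<close> and under \<open>Q\<close>, then the polynomial \<open>G = \<Sum> r\<^sub>\<beta> H\<^sub>\<beta> / \<beta>!\<close> in the noise (sum over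
  \<open>0 < \<bar>\<beta>\<bar> \<le> D\<close>, multivariate Hermite polynomials \<open>H\<^sub>\<beta>\<close>) satisfies
  \<open>E\<^sub>P f(Y) - E\<^sub>Q f(Y) = E\<^sub>Q f(Y) G(Z)\<close> for all \<open>f\<close> of degree at most \<open>D\<close>, so by Cauchy-Schwarz the
  squared gap is at most \<open>Var\<^sub>Q f\<close> times \<open>\<Sum> r\<^sub>\<beta>\<^sup>2 / \<beta>!\<close>. View \<open>\<beta>\<close> as a multigraph. Moments
  of forests do not depend on the community structure, and \<open>r\<^sub>\<beta>\<close> vanishes as soon as \<open>\<beta>\<close> has a tree
  component. Hence only \<open>\<beta>\<close> with at most as many vertices as edges contribute, and for these crude
  moment bounds and counting suffice. The degree-1 test in the second part is the trace.
\<close>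

section \<open>Univariate Hermite polynomials and Gaussian expectations\<close>

text \<open>\<open>Q\<close> is itself a mixture, so the comparison is made conditionally on its
  labels: there the noise has exact Hermite orthogonality, and \<open>G\<close> has the same second
  moment for every label vector. Forest moments agree because averaging over the label of a leaf
  multiplies the chance \<open>x l * k / n\<close> of joining the neighbour's community by the
  signal \<open>lam / x l\<close>; the proportion cancels and \<open>lam * k / n\<close> remains,
  whatever the community. The factor of a tree component therefore cancels in the quotient of
  generating functions. Exact removal of trees matters for the counting. For \<open>d\<close> edges
  on \<open>v\<close> vertices the bound on the squared coefficient carries
  \<open>(k / n) ^ (2 * v)\<close>, while there are of order \<open>n ^ v\<close> vertex sets. The
  product \<open>(k^2 / n) ^ v\<close> is at most \<open>max (k^2 / n) 1 ^ d\<close> as long as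
  \<open>v \<le> d\<close>; a tree, with \<open>v = d + 1\<close>, would leave a spare factor
  \<open>k^2 / n\<close>. Of the powers of \<open>D\<close> that arise, two come from the recursion
  for the quotient and two from placing the edges.\<close>

primrec hermite :: "nat \<Rightarrow> real poly" where
  "hermite 0 = 1"
| "hermite (Suc n) = [:0, 1:] * hermite n - pderiv (hermite n)"

lemma pderiv_hermite: "pderiv (hermite (Suc n)) = smult (real (Suc n)) (hermite n)"
proof (induction n)
  case 0
  show ?case by (simp add: pderiv_pCons)
next
  case (Suc n)
  have "pderiv (hermite (Suc (Suc n)))
      = hermite (Suc n) + [:0, 1:] * pderiv (hermite (Suc n)) - pderiv (pderiv (hermite (Suc n)))"
    by (subst hermite.simps(2)) (simp add: pderiv_diff pderiv_mult pderiv_pCons del: hermite.simps)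
  also have "\<dots> = hermite (Suc n) + smult (real (Suc n)) (hermite (Suc n))"
    unfolding Suc.IH by (simp add: pderiv_smult smult_diff_right)
  also have "\<dots> = smult (real (Suc (Suc n))) (hermite (Suc n))"
    by (metis add.commute of_nat_Suc smult_1_left smult_add_left)
  finally show ?case .
qed

lemma coeff_hermite:
  "coeff (hermite n) n = 1" "n < i \<Longrightarrow> coeff (hermite n) i = 0"
proof -
  have "coeff (hermite n) n = 1 \<and> (\<forall>i>n. coeff (hermite n) i = 0)"
    by (induction n) (auto simp: coeff_pderiv coeff_pCons split: nat.splits)
  then show "coeff (hermite n) n = 1" "n < i \<Longrightarrow> coeff (hermite n) i = 0" by auto
qed

lemma hermite_span:
  assumes "\<And>i. n < i \<Longrightarrow> coeff p i = 0"
  shows "\<exists>c. p = (\<Sum>j\<le>n. smult (c j) (hermite j))"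
  using assms
proof (induction n arbitrary: p)
  case 0
  have "p = smult (coeff p 0) (hermite 0)"
    using 0 by (intro poly_eqI) (case_tac n, auto)
  then show ?case by (intro exI[of _ "\<lambda>_. coeff p 0"]) simp
next
  case (Suc n)
  define q where "q = p - smult (coeff p (Suc n)) (hermite (Suc n))"
  have "coeff q i = 0" if "n < i" for i
    using that Suc.prems[of i] coeff_hermite(1)[of "Suc n"] coeff_hermite(2)[of "Suc n" i]
    by (cases "i = Suc n") (auto simp: q_def simp del: hermite.simps)
  from Suc.IH[OF this] obtain c where c: "q = (\<Sum>j\<le>n. smult (c j) (hermite j))" by blast
  have "p = (\<Sum>j\<le>Suc n. smult ((c(Suc n := coeff p (Suc n))) j) (hermite j))"
    using c by (simp add: q_def algebra_simps del: hermite.simps)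
  then show ?case by blast
qed

text \<open>A functional on \<open>real poly\<close> rather than on functions: integrability is
  settled once, and the later identities become algebra with \<open>pderiv\<close> and
  \<open>pcompose\<close>.\<close>

definition gauss :: "real poly \<Rightarrow> real" where
  "gauss p = (\<integral>z. poly p z \<partial>density lborel std_normal_density)"

text \<open>\<open>N(s, 1)\<close> is the law of \<open>Z + s\<close>, so a mean shift can be moved
  from the measure into the polynomial.\<close>

lemma has_bochner_integral_normal_poly:
  "has_bochner_integral (density lborel (normal_density s 1)) (poly p) (gauss (p \<circ>\<^sub>p [:s, 1:]))"
proof -
  have pw: "integrable (density lborel std_normal_density) (\<lambda>z. z ^ k)" for k
    by (subst integrable_density) (use integrable_std_normal_moment in auto)
  have "integrable (density lborel std_normal_density) (\<lambda>z. \<Sum>i\<le>degree q. coeff q i * z ^ i)" for q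
    by (intro Bochner_Integration.integrable_sum integrable_mult_right pw)
  then have int: "integrable (density lborel std_normal_density) (poly q)" for q
    by (simp add: poly_altdef[abs_def])
  have eq: "density lborel (normal_density s 1) = distr (density lborel std_normal_density) borel (\<lambda>z. z + s)"
  proof -
    have d: "distributed (density lborel std_normal_density) lborel (\<lambda>z. z) (normal_density 0 1)"
      by (auto simp: distributed_def distr_id2)
    interpret prob_space "density lborel std_normal_density" 
      by (rule prob_space_normal_density) simp
    from normal_density_affine[OF d, of 1 s] show ?thesis
      by (simp add: distributed_def add.commute cong: distr_cong)
  qed
  have m [measurable]: "poly q \<in> borel_measurable borel" for q :: "real poly"
    by (intro borel_measurable_continuous_onI continuous_intros)
  have sh: "poly (p \<circ>\<^sub>p [:s, 1:]) = (\<lambda>x. poly p (x + s))"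
    by (simp add: fun_eq_iff poly_pcompose add.commute)
  have "integrable (density lborel (normal_density s 1)) (poly p)"
    unfolding eq using int[of "p \<circ>\<^sub>p [:s, 1:]"]
    by (subst integrable_distr_eq) (auto simp: sh)
  moreover have "(\<integral>y. poly p y \<partial>density lborel (normal_density s 1)) = gauss (p \<circ>\<^sub>p [:s, 1:])"
    unfolding eq gauss_def by (subst integral_distr) (auto simp: sh)
  ultimately show ?thesis by (simp add: has_bochner_integral_iff)
qed

lemma integrable_std_normal_poly: "integrable (density lborel std_normal_density) (poly p)"
  using has_bochner_integral_normal_poly[of 0 p] by (simp add: has_bochner_integral_iff)

lemma gauss_add: "gauss (p + q) = gauss p + gauss q"
  and gauss_diff: "gauss (p - q) = gauss p - gauss q"
  and gauss_smult: "gauss (smult c p) = c * gauss p"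
  by (simp_all add: gauss_def integrable_std_normal_poly)

lemma gauss_sum: "gauss (sum f A) = (\<Sum>a\<in>A. gauss (f a))"
  unfolding gauss_def poly_sum
  by (rule Bochner_Integration.integral_sum) (rule integrable_std_normal_poly)

lemma gauss_1: "gauss 1 = 1"
  using prob_space.prob_space[OF prob_space_normal_density[of 1 0]] by (simp add: gauss_def)

lemma gauss_monom:
  "gauss (monom 1 (2 * k)) = fact (2 * k) / (2 ^ k * fact k)" "gauss (monom 1 (2 * k + 1)) = 0"
proof -
  have e: "gauss (monom 1 j) = (\<integral>z. std_normal_density z * z ^ j \<partial>lborel)" for j
    unfolding gauss_def by (subst integral_density) (auto simp: poly_monom intro!: borel_measurable_continuous_onI continuous_intros)
  show "gauss (monom 1 (2 * k)) = fact (2 * k) / (2 ^ k * fact k)"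
    unfolding e by (rule integral_std_normal_moment_even)
  show "gauss (monom 1 (2 * k + 1)) = 0"
    unfolding e by (rule integral_std_normal_moment_odd)
qed

lemma gauss_stein_monom: "gauss (monom 1 (Suc i)) = real i * gauss (monom 1 (i - 1))"
proof (cases "even i")
  case True
  then obtain k where i: "i = 2 * k" by (elim evenE)
  have "gauss (monom 1 (Suc i)) = 0" using gauss_monom(2)[of k] i by simp
  moreover have "real i * gauss (monom 1 (i - 1)) = 0"
  proof (cases k)
    case (Suc j)
    then show ?thesis using gauss_monom(2)[of j] i by simp
  qed (simp add: i)
  ultimately show ?thesis by simp
next
  case False
  then obtain k where i: "i = 2 * k + 1" by (elim oddE)
  have "Suc i = 2 * Suc k" using i by simp
  then have "gauss (monom 1 (Suc i)) = fact (2 * Suc k) / (2 ^ Suc k * fact (Suc k))"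
    using gauss_monom(1)[of "Suc k"] by metis
  also have "\<dots> = real i * (fact (2 * k) / (2 ^ k * fact k))"
  proof -
    have "(fact (2 * Suc k) :: real) = (2 * real k + 2) * (2 * real k + 1) * fact (2 * k)"
      by (simp add: algebra_simps)
    moreover have "(fact (Suc k) :: real) = (real k + 1) * fact k" by (simp add: algebra_simps)
    ultimately show ?thesis using i by (simp add: divide_simps del: fact_Suc)
  qed
  finally show ?thesis using gauss_monom(1)[of k] i by simp
qed

text \<open>Gaussian integration by parts. By linearity it reduces to monomials, where it is the
  recursion between the moments of order \<open>i + 1\<close> and \<open>i - 1\<close>.\<close>

lemma gauss_stein: "gauss ([:0, 1:] * p) = gauss (pderiv p)"
proof -
  have p: "p = (\<Sum>i\<le>degree p. smult (coeff p i) (monom 1 i))"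
    by (simp add: smult_monom poly_as_sum_of_monoms)
  have x: "[:0, 1:] * smult c (monom 1 i) = smult c (monom 1 (Suc i))" for c :: real and i
    by (simp add: monom_Suc)
  have "gauss ([:0, 1:] * p) = (\<Sum>i\<le>degree p. coeff p i * gauss (monom 1 (Suc i)))"
    by (subst (1) p) (simp only: sum_distrib_left x gauss_sum gauss_smult)
  also have "\<dots> = (\<Sum>i\<le>degree p. coeff p i * gauss (pderiv (monom 1 i)))"
    using gauss_stein_monom
    by (intro sum.cong) (simp_all add: pderiv_monom flip: gauss_smult, simp add: smult_monom)
  also have "\<dots> = gauss (pderiv p)"
    by (subst (3) p) (simp add: higher_pderiv_sum[of 1, simplified] gauss_sum gauss_smult pderiv_smult)
  finally show ?thesis .
qed

lemma pderiv_shift: "pderiv (p \<circ>\<^sub>p [:t, 1:]) = pderiv p \<circ>\<^sub>p [:t, 1:]" for p :: "real poly"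
  by (simp add: pderiv_pcompose pderiv_pCons)

text \<open>Hermite polynomials of signal plus noise are unbiased for powers of the signal: in the
  shifted recursion the term with \<open>[:0, 1:]\<close> and the derivative cancel by Stein,
  leaving a factor \<open>t\<close>.\<close>

lemma gauss_hermite_shift: "gauss (hermite d \<circ>\<^sub>p [:t, 1:]) = t ^ d"
proof (induction d)
  case 0
  show ?case by (simp add: gauss_1 pcompose_1)
next
  case (Suc d)
  let ?q = "hermite d \<circ>\<^sub>p [:t, 1:]"
  have "hermite (Suc d) \<circ>\<^sub>p [:t, 1:] = smult t ?q + [:0, 1:] * ?q - pderiv ?q"
    by (simp add: pcompose_diff pcompose_mult pcompose_pCons pderiv_shift)
  then show ?case by (simp only: gauss_add gauss_diff gauss_smult gauss_stein Suc.IH) simp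
qed

text \<open>The source of the binomial convolution used throughout: the binomial coefficient is 0
  for \<open>b > d\<close>, and \<open>t = 0\<close> gives orthogonality. Induction on
  \<open>b\<close> works because raising a Hermite index is adjoint to differentiation, and
  differentiation lowers the other index.\<close>

lemma gauss_hermite_mult:
  "gauss (hermite b * hermite d \<circ>\<^sub>p [:t, 1:]) = real (d choose b) * fact b * t ^ (d - b)"
proof (induction b arbitrary: d)
  case 0
  show ?case by (simp add: gauss_hermite_shift)
next
  case (Suc b)
  have *: "gauss (hermite (Suc b) * q) = gauss (hermite b * pderiv q)" for q
  proof -
    have "hermite (Suc b) * q = [:0, 1:] * (hermite b * q) - pderiv (hermite b) * q"
      by (simp add: algebra_simps)
    then have "gauss (hermite (Suc b) * q) = gauss (pderiv (hermite b * q)) - gauss (pderiv (hermite b) * q)"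
      by (simp only: gauss_diff gauss_stein)
    then show ?thesis by (simp add: pderiv_mult gauss_add mult.commute)
  qed
  show ?case
  proof (cases d)
    case 0
    then show ?thesis using gauss_smult[of 0] by (simp add: * pderiv_shift del: hermite.simps(2))
  next
    case (Suc d')
    have "gauss (hermite (Suc b) * hermite d \<circ>\<^sub>p [:t, 1:])
        = real d * (real (d' choose b) * fact b * t ^ (d' - b))"
      unfolding * pderiv_shift Suc pderiv_hermite pcompose_smult mult_smult_right gauss_smult Suc.IH ..
    also have "\<dots> = (real d * real (d' choose b)) * fact b * t ^ (d' - b)" by simp
    also have "real d * real (d' choose b) = real (Suc b) * real (d choose Suc b)"
      unfolding Suc of_nat_mult[symmetric] by (simp only: Suc_times_binomial)
    also have "real (Suc b) * real (d choose Suc b) * fact b * t ^ (d' - b)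
        = real (d choose Suc b) * fact (Suc b) * t ^ (d - Suc b)"
      by (simp only: fact_Suc Suc diff_Suc_Suc) (simp add: mult_ac)
    finally show ?thesis .
  qed
qed

section \<open>Resampling one coordinate of a product distribution\<close>

text \<open>Overwriting one coordinate by a fresh independent draw preserves the product law. This
  allows a single label to be averaged out while the others stay fixed.\<close>

lemma Pi_pmf_resample:
  assumes "finite A" "v \<in> A"
  shows "Pi_pmf A d p = bind_pmf (Pi_pmf A d p) (\<lambda>\<sigma>. map_pmf (\<lambda>s. \<sigma>(v := s)) (p v))"
proof -
  have A: "A = insert v (A - {v})" using assms by auto
  have upd: "fun_upd (f(v := y)) v = fun_upd f v" for f :: "'a \<Rightarrow> 'b" and y by auto
  have "bind_pmf (Pi_pmf A d p) (\<lambda>\<sigma>. map_pmf (\<lambda>s. \<sigma>(v := s)) (p v)) = 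
     bind_pmf (Pi_pmf (A - {v}) d p) (\<lambda>f. map_pmf (\<lambda>s. f(v := s)) (p v))"
    by (subst A, subst Pi_pmf_insert') (use assms in \<open>simp_all add: bind_assoc_pmf bind_return_pmf upd\<close>)
  also have "\<dots> = bind_pmf (p v) (\<lambda>s. bind_pmf (Pi_pmf (A - {v}) d p) (\<lambda>f. return_pmf (f(v := s))))"
    by (simp add: map_pmf_def) (rule bind_commute_pmf)
  also have "\<dots> = Pi_pmf A d p"
    by (subst (2) A, subst Pi_pmf_insert') (use assms in auto)
  finally show ?thesis ..
qed

lemma finite_set_Pi_pmf:
  assumes "finite A" "\<And>a. a \<in> A \<Longrightarrow> finite (set_pmf (p a))"
  shows "finite (set_pmf (Pi_pmf A d p))"
  using assms by (simp add: set_Pi_pmf finite_PiE_dflt)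

lemma expectation_Pi_pmf_resample:
  fixes h :: "('a \<Rightarrow> 'b) \<Rightarrow> real"
  assumes "finite A" "v \<in> A" and fin: "\<And>a. a \<in> A \<Longrightarrow> finite (set_pmf (p a))"
  shows "measure_pmf.expectation (Pi_pmf A d p) h =
    measure_pmf.expectation (Pi_pmf A d p) (\<lambda>\<sigma>. measure_pmf.expectation (p v) (\<lambda>s. h (\<sigma>(v := s))))"
proof -
  let ?S = "set_pmf (Pi_pmf A d p)"
  have S: "finite ?S" using assms by (intro finite_set_Pi_pmf)
  have "measure_pmf.expectation (Pi_pmf A d p) h =
     (\<Sum>\<sigma>\<in>?S. pmf (Pi_pmf A d p) \<sigma> *\<^sub>R measure_pmf.expectation (map_pmf (\<lambda>s. \<sigma>(v := s)) (p v)) h)"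
    by (subst Pi_pmf_resample[OF assms(1,2)], subst pmf_expectation_bind[OF S])
       (use fin assms in auto)
  also have "\<dots> = measure_pmf.expectation (Pi_pmf A d p) (\<lambda>\<sigma>. measure_pmf.expectation (p v) (\<lambda>s. h (\<sigma>(v := s))))"
    by (subst integral_measure_pmf[OF S]) auto
  finally show ?thesis .
qed

text \<open>Resampling a coordinate \<open>v\<close> of \<open>S\<close> replaces \<open>F\<close>
  by its average over that coordinate and leaves \<open>G\<close> alone. After all of
  \<open>S\<close> has been averaged out, \<open>F\<close> is constant and factors out.\<close>

lemma expectation_Pi_pmf_indep:
  fixes F G :: "('a \<Rightarrow> 'b) \<Rightarrow> real"
  assumes A: "finite A" and fin: "\<And>a. a \<in> A \<Longrightarrow> finite (set_pmf (p a))"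
    and S: "finite S" "S \<subseteq> A"
    and F: "\<And>\<sigma> \<tau>. (\<And>a. a \<in> S \<Longrightarrow> \<sigma> a = \<tau> a) \<Longrightarrow> F \<sigma> = F \<tau>"
    and G: "\<And>\<sigma> \<tau>. (\<And>a. a \<notin> S \<Longrightarrow> \<sigma> a = \<tau> a) \<Longrightarrow> G \<sigma> = G \<tau>"
  shows "measure_pmf.expectation (Pi_pmf A d p) (\<lambda>\<sigma>. F \<sigma> * G \<sigma>) =
    measure_pmf.expectation (Pi_pmf A d p) F * measure_pmf.expectation (Pi_pmf A d p) G"
  using S F G
proof (induction S arbitrary: F rule: finite_induct)
  case empty
  then have "F = (\<lambda>_. F undefined)" by (intro ext) auto
  then obtain c where "F = (\<lambda>_. c)" by blast
  then show ?case by simp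
next
  case (insert v S)
  let ?E = "measure_pmf.expectation (Pi_pmf A d p)"
  define F' where "F' = (\<lambda>\<sigma>. measure_pmf.expectation (p v) (\<lambda>s. F (\<sigma>(v := s))))"
  have v: "v \<in> A" using insert.prems by auto
  have G: "G (\<sigma>(v := s)) = G \<sigma>" for \<sigma> s by (rule insert.prems) auto
  have "?E (\<lambda>\<sigma>. F \<sigma> * G \<sigma>) = ?E (\<lambda>\<sigma>. F' \<sigma> * G \<sigma>)"
    by (subst expectation_Pi_pmf_resample[OF A v fin]) (simp_all add: G F'_def)
  also have "\<dots> = ?E F' * ?E G"
  proof (rule insert.IH)
    show "F' \<sigma> = F' \<tau>" if "\<And>a. a \<in> S \<Longrightarrow> \<sigma> a = \<tau> a" for \<sigma> \<tau>
      unfolding F'_def by (intro arg_cong[of _ _ "\<lambda>h. measure_pmf.expectation (p v) h"] ext insert.prems)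
        (use that in auto)
    show "G \<sigma> = G \<tau>" if "\<And>a. a \<notin> S \<Longrightarrow> \<sigma> a = \<tau> a" for \<sigma> \<tau>
      by (rule insert.prems) (use that in auto)
  qed (use insert.prems in auto)
  also have "?E F' = ?E F"
    unfolding F'_def by (rule expectation_Pi_pmf_resample[OF A v fin, symmetric])
  finally show ?case .
qed

section \<open>Multivariate Hermite polynomials and the Gaussian model\<close>

text \<open>Forcing the value 0 off \<open>E\<close> gives each monomial in the coordinates of
  \<open>E\<close> a single exponent vector and makes the index set finite.\<close>

definition midx :: "'i set \<Rightarrow> nat \<Rightarrow> ('i \<Rightarrow> nat) set" where
  "midx E D = {\<alpha>. (\<forall>e. e \<notin> E \<longrightarrow> \<alpha> e = 0) \<and> sum \<alpha> E \<le> D}"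

definition hermite_prod :: "'i set \<Rightarrow> ('i \<Rightarrow> nat) \<Rightarrow> ('i \<Rightarrow> real) \<Rightarrow> real" where
  "hermite_prod E \<alpha> y = (\<Prod>e\<in>E. poly (hermite (\<alpha> e)) (y e))"

lemma finite_midx: "finite E \<Longrightarrow> finite (midx E D)"
proof (rule finite_subset)
  assume E: "finite E"
  show "midx E D \<subseteq> PiE_dflt E 0 (\<lambda>_. {..D})"
  proof
    fix \<alpha> assume a: "\<alpha> \<in> midx E D"
    have "\<alpha> e \<le> D" if "e \<in> E" for e
      using a member_le_sum[OF that, of \<alpha>] E by (auto simp: midx_def)
    with a show "\<alpha> \<in> PiE_dflt E 0 (\<lambda>_. {..D})" by (auto simp: PiE_dflt_def midx_def)
  qed
  show "finite (PiE_dflt E (0::nat) (\<lambda>_. {..D}))" using E by (intro finite_PiE_dflt) auto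
qed

text \<open>In the pointwise order the down-set of a multi-index is a product of intervals, so a
  product of sums expands into a sum over it.\<close>

lemma atMost_eq_PiE_dflt:
  fixes \<alpha> :: "'i \<Rightarrow> nat"
  assumes "\<And>e. e \<notin> E \<Longrightarrow> \<alpha> e = 0"
  shows "{..\<alpha>} = PiE_dflt E 0 (\<lambda>e. {..\<alpha> e})"
proof -
  have "\<beta> \<le> \<alpha> \<longleftrightarrow> \<beta> \<in> PiE_dflt E 0 (\<lambda>e. {..\<alpha> e})" for \<beta>
    unfolding PiE_dflt_def le_fun_def using assms by (auto, metis le_zero_eq, metis le_zero_eq order_refl)
  then show ?thesis by auto
qed

lemma finite_atMost_midx: "finite E \<Longrightarrow> \<alpha> \<in> midx E D \<Longrightarrow> finite {..\<alpha>}"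
  by (subst atMost_eq_PiE_dflt[of E]) (auto simp: midx_def)

lemma midx_mono: "\<beta> \<le> \<alpha> \<Longrightarrow> \<alpha> \<in> midx E D \<Longrightarrow> \<beta> \<in> midx E D"
  unfolding midx_def le_fun_def
  by (auto intro: order_trans[OF sum_mono] simp: le_fun_def) (metis le_zero_eq)

lemma prod_sum_PiE_dflt:
  fixes f :: "'a \<Rightarrow> 'b \<Rightarrow> 'c :: comm_semiring_1"
  assumes A: "finite A" and B: "\<And>x. x \<in> A \<Longrightarrow> finite (B x)"
  shows "(\<Prod>x\<in>A. \<Sum>y\<in>B x. f x y) = (\<Sum>g\<in>PiE_dflt A d B. \<Prod>x\<in>A. f x (g x))"
proof -
  have "inj_on (\<lambda>h x. if x \<in> A then h x else d) (PiE A B)"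
  proof (rule inj_onI)
    fix g h :: "'a \<Rightarrow> 'b" assume gh: "g \<in> PiE A B" "h \<in> PiE A B"
      and eq: "(\<lambda>x. if x \<in> A then g x else d) = (\<lambda>x. if x \<in> A then h x else d)"
    show "g = h" using gh
    proof (rule PiE_ext)
      show "g x = h x" if "x \<in> A" for x using fun_cong[OF eq, of x] that by simp
    qed
  qed
  then have "(\<Sum>g\<in>PiE_dflt A d B. \<Prod>x\<in>A. f x (g x)) = (\<Sum>g\<in>PiE A B. \<Prod>x\<in>A. f x (g x))"
    unfolding dflt_image_PiE[symmetric] by (simp add: sum.reindex)
  then show ?thesis using prod_sum_PiE[of A B f] assms by simp
qed

lemma prod_sum_atMost:
  fixes f :: "'i \<Rightarrow> nat \<Rightarrow> 'c :: comm_semiring_1"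
  assumes "finite E" "\<And>e. e \<notin> E \<Longrightarrow> \<alpha> e = 0"
  shows "(\<Prod>e\<in>E. \<Sum>j\<le>\<alpha> e. f e j) = (\<Sum>\<beta>\<le>\<alpha>. \<Prod>e\<in>E. f e (\<beta> e))"
  by (subst atMost_eq_PiE_dflt[OF assms(2)], assumption, rule prod_sum_PiE_dflt) (use assms in auto)

text \<open>Each power \<open>y e ^ g\<close> expands in Hermite polynomials of index at most
  \<open>g\<close>; multiplying out over the coordinates does not raise the total degree.\<close>

lemma poly_fun_on_hermite_prod_span:
  assumes E: "finite E" and f: "poly_fun_on E D f"
  shows "\<exists>c. \<forall>y. f y = (\<Sum>\<delta>\<in>midx E D. c \<delta> * hermite_prod E \<delta> y)"
proof -
  have "\<exists>c. \<forall>x::real. x ^ g = (\<Sum>j\<le>g. c j * poly (hermite j) x)" for g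
  proof -
    have "\<exists>c. monom 1 g = (\<Sum>j\<le>g. smult (c j) (hermite j))"
      by (rule hermite_span) simp
    then obtain c where "monom 1 g = (\<Sum>j\<le>g. smult (c j) (hermite j))" by blast
    from arg_cong[OF this, of poly] show ?thesis
      by (intro exI[of _ c]) (auto simp: fun_eq_iff poly_monom poly_sum)
  qed
  then obtain c where c: "x ^ g = (\<Sum>j\<le>g. c g j * poly (hermite j) x)" for g and x :: real
    by metis
  obtain A a where A: "finite A" "\<And>\<alpha>. \<alpha> \<in> A \<Longrightarrow> sum \<alpha> E \<le> D"
    and fa: "\<And>y. f y = (\<Sum>\<alpha>\<in>A. a \<alpha> * (\<Prod>e\<in>E. y e ^ \<alpha> e))"
    using f unfolding poly_fun_on_def by blast
  define b where "b \<alpha> \<delta> = (if \<delta> \<in> PiE_dflt E 0 (\<lambda>e. {..\<alpha> e}) then \<Prod>e\<in>E. c (\<alpha> e) (\<delta> e) else 0)"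
    for \<alpha> \<delta> :: "'a \<Rightarrow> nat"
  have mon: "(\<Prod>e\<in>E. y e ^ \<alpha> e) = (\<Sum>\<delta>\<in>midx E D. b \<alpha> \<delta> * hermite_prod E \<delta> y)" if "\<alpha> \<in> A" for \<alpha> y
  proof -
    have sub: "PiE_dflt E 0 (\<lambda>e. {..\<alpha> e}) \<subseteq> midx E D"
    proof
      fix \<delta> assume "\<delta> \<in> PiE_dflt E 0 (\<lambda>e. {..\<alpha> e})"
      then show "\<delta> \<in> midx E D"
        using sum_mono[of E \<delta> \<alpha>] A(2)[OF that] by (auto simp: PiE_dflt_def midx_def)
    qed
    have "(\<Prod>e\<in>E. y e ^ \<alpha> e) = (\<Sum>\<delta>\<in>PiE_dflt E 0 (\<lambda>e. {..\<alpha> e}).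
        \<Prod>e\<in>E. c (\<alpha> e) (\<delta> e) * poly (hermite (\<delta> e)) (y e))"
      by (subst c, subst prod_sum_PiE_dflt[where d = 0]) (use E in auto)
    also have "\<dots> = (\<Sum>\<delta>\<in>midx E D. b \<alpha> \<delta> * hermite_prod E \<delta> y)"
      by (rule sum.mono_neutral_cong_left)
         (use sub finite_midx[OF E] in \<open>auto simp: b_def hermite_prod_def prod.distrib\<close>)
    finally show ?thesis .
  qed
  have "f y = (\<Sum>\<delta>\<in>midx E D. (\<Sum>\<alpha>\<in>A. a \<alpha> * b \<alpha> \<delta>) * hermite_prod E \<delta> y)" for y
    unfolding fa by (simp add: mon sum_distrib_left sum_distrib_right mult.assoc, rule sum.swap)
  then show ?thesis by (intro exI allI)
qed

section \<open>Integration against Gaussian products and mixtures over labels\<close>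

abbreviation normal_meas :: "real \<Rightarrow> real measure" where
  "normal_meas s \<equiv> density lborel (normal_density s 1)"

lemma has_bochner_integral_PiM_normal_poly:
  assumes E: "finite E"
  shows "has_bochner_integral (PiM E (\<lambda>e. normal_meas (s e)))
    (\<lambda>y. \<Prod>e\<in>E. poly (p e) (y e)) (\<Prod>e\<in>E. gauss (p e \<circ>\<^sub>p [:s e, 1:]))"
proof -
  interpret product_sigma_finite "\<lambda>e. normal_meas (s e)"
    unfolding product_sigma_finite_def
    using prob_space_imp_sigma_finite[OF prob_space_normal_density[of 1]] by simp
  show ?thesis
    using product_integrable_prod[OF E, of "\<lambda>e. poly (p e)"] product_integral_prod[OF E, of "\<lambda>e. poly (p e)"]
      has_bochner_integral_normal_poly
    by (simp add: has_bochner_integral_iff)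
qed

text \<open>The shift \<open>t\<close> is kept independent of the mean \<open>s\<close>:
  \<open>t = s\<close> gives a Hermite product in the observation itself, \<open>t = 0\<close> one
  in the pure noise.\<close>

lemma has_bochner_integral_hermite_prod_mult:
  assumes E: "finite E"
  shows "has_bochner_integral (PiM E (\<lambda>e. normal_meas (s e)))
    (\<lambda>y. hermite_prod E \<delta> (\<lambda>e. y e - s e + t e) * hermite_prod E \<beta> (\<lambda>e. y e - s e))
    (\<Prod>e\<in>E. real (\<delta> e choose \<beta> e) * fact (\<beta> e) * t e ^ (\<delta> e - \<beta> e))"
proof -
  define p where "p e = hermite (\<delta> e) \<circ>\<^sub>p [:t e - s e, 1:] * hermite (\<beta> e) \<circ>\<^sub>p [:- s e, 1:]" for e
  have "(\<lambda>y. hermite_prod E \<delta> (\<lambda>e. y e - s e + t e) * hermite_prod E \<beta> (\<lambda>e. y e - s e))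
      = (\<lambda>y. \<Prod>e\<in>E. poly (p e) (y e))"
    by (simp add: fun_eq_iff hermite_prod_def prod.distrib[symmetric] p_def poly_pcompose algebra_simps)
  moreover have "gauss (p e \<circ>\<^sub>p [:s e, 1:]) = real (\<delta> e choose \<beta> e) * fact (\<beta> e) * t e ^ (\<delta> e - \<beta> e)" for e
  proof -
    have "p e \<circ>\<^sub>p [:s e, 1:] = hermite (\<beta> e) * hermite (\<delta> e) \<circ>\<^sub>p [:t e, 1:]"
      by (simp add: p_def pcompose_mult pcompose_assoc[symmetric] pcompose_pCons mult.commute pcompose_idR)
    then show ?thesis by (simp add: gauss_hermite_mult)
  qed
  ultimately show ?thesis
    using has_bochner_integral_PiM_normal_poly[OF E, of s p] by simp
qed

lemma has_bochner_integral_bind_pmf_nonneg: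
  fixes g :: "'b \<Rightarrow> real"
  assumes K: "K \<in> measurable (measure_pmf p) (subprob_algebra B)" and p: "finite (set_pmf p)"
    and g: "\<And>\<sigma>. integrable (K \<sigma>) g" "g \<in> borel_measurable B" "\<And>y. 0 \<le> g y"
  shows "has_bochner_integral (measure_pmf p \<bind> K) g (measure_pmf.expectation p (\<lambda>\<sigma>. \<integral>y. g y \<partial>K \<sigma>))"
proof (rule has_bochner_integral_nn_integral)
  have sets: "sets (measure_pmf p \<bind> K) = sets B"
    by (rule sets_bind) (use subprob_measurableD(2)[OF K] in auto)
  show "g \<in> borel_measurable (measure_pmf p \<bind> K)"
    using g(2) by (simp cong: measurable_cong_sets add: measurable_cong_sets[OF sets refl])
  show "0 \<le> measure_pmf.expectation p (\<lambda>\<sigma>. \<integral>y. g y \<partial>K \<sigma>)"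
    by (intro integral_nonneg_AE AE_I2) (use g in \<open>auto intro!: integral_nonneg_AE\<close>)
  have "(\<integral>\<^sup>+ y. ennreal (g y) \<partial>(measure_pmf p \<bind> K)) = (\<integral>\<^sup>+\<sigma>. \<integral>\<^sup>+y. ennreal (g y) \<partial>K \<sigma> \<partial>p)"
    by (rule nn_integral_bind[OF _ K]) (use g in measurable)
  also have "\<dots> = (\<integral>\<^sup>+\<sigma>. ennreal (\<integral>y. g y \<partial>K \<sigma>) \<partial>p)"
    by (intro nn_integral_cong nn_integral_eq_integral) (use g in auto)
  also have "\<dots> = ennreal (measure_pmf.expectation p (\<lambda>\<sigma>. \<integral>y. g y \<partial>K \<sigma>))"
    by (intro nn_integral_eq_integral integrable_measure_pmf_finite p)
       (use g in \<open>auto intro!: integral_nonneg_AE\<close>)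
  finally show "(\<integral>\<^sup>+ y. ennreal (g y) \<partial>(measure_pmf p \<bind> K))
      = ennreal (measure_pmf.expectation p (\<lambda>\<sigma>. \<integral>y. g y \<partial>K \<sigma>))" .
qed (use g in auto)

lemma has_bochner_integral_bind_pmf:
  fixes f :: "'b \<Rightarrow> real"
  assumes K: "K \<in> measurable (measure_pmf p) (subprob_algebra B)" and p: "finite (set_pmf p)"
    and f: "\<And>\<sigma>. integrable (K \<sigma>) f" "f \<in> borel_measurable B"
  shows "has_bochner_integral (measure_pmf p \<bind> K) f (measure_pmf.expectation p (\<lambda>\<sigma>. \<integral>y. f y \<partial>K \<sigma>))"
proof -
  let ?E = "measure_pmf.expectation p"
  have "has_bochner_integral (measure_pmf p \<bind> K) (\<lambda>y. max 0 (f y) - max 0 (- f y))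
      (?E (\<lambda>\<sigma>. \<integral>y. max 0 (f y) \<partial>K \<sigma>) - ?E (\<lambda>\<sigma>. \<integral>y. max 0 (- f y) \<partial>K \<sigma>))"
    by (intro has_bochner_integral_diff has_bochner_integral_bind_pmf_nonneg[OF K p])
       (use f in \<open>auto intro!: integrable_max\<close>)
  also have "?E (\<lambda>\<sigma>. \<integral>y. max 0 (f y) \<partial>K \<sigma>) - ?E (\<lambda>\<sigma>. \<integral>y. max 0 (- f y) \<partial>K \<sigma>)
      = ?E (\<lambda>\<sigma>. (\<integral>y. max 0 (f y) \<partial>K \<sigma>) - (\<integral>y. max 0 (- f y) \<partial>K \<sigma>))"
    by (intro Bochner_Integration.integral_diff[symmetric] integrable_measure_pmf_finite p)
  also have "(\<lambda>\<sigma>. (\<integral>y. max 0 (f y) \<partial>K \<sigma>) - (\<integral>y. max 0 (- f y) \<partial>K \<sigma>))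
      = (\<lambda>\<sigma>. \<integral>y. max 0 (f y) - max 0 (- f y) \<partial>K \<sigma>)"
    by (intro ext Bochner_Integration.integral_diff[symmetric]) (use f in \<open>auto intro!: integrable_max\<close>)
  also have "(\<lambda>y. max 0 (f y) - max 0 (- f y)) = f" by (auto simp: max_def)
  finally show ?thesis .
qed

definition labels :: "nat \<Rightarrow> real \<Rightarrow> nat \<Rightarrow> (nat \<Rightarrow> real) \<Rightarrow> (nat \<Rightarrow> nat option) pmf" where
  "labels n k M x = Pi_pmf {1..n} None (\<lambda>_. label_pmf n k M x)"

lemma set_label_pmf:
  assumes "valid_params n k lam M x"
  shows "set_pmf (label_pmf n k M x) \<subseteq> insert None (Some ` {1..M})"
proof
  fix s assume "s \<in> set_pmf (label_pmf n k M x)"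
  then show "s \<in> insert None (Some ` {1..M})"
    by (cases s) (auto simp: set_pmf_iff pmf_label_pmf[OF assms] split: if_splits)
qed

lemma finite_set_label_pmf:
  assumes "valid_params n k lam M x"
  shows "finite (set_pmf (label_pmf n k M x))"
  using finite_subset[OF set_label_pmf[OF assms]] by simp

lemma finite_set_labels:
  assumes "valid_params n k lam M x"
  shows "finite (set_pmf (labels n k M x))"
  unfolding labels_def by (intro finite_set_Pi_pmf finite_set_label_pmf[OF assms]) auto

lemma has_bochner_integral_gaussian_model:
  fixes f :: "_ \<Rightarrow> real"
  assumes v: "valid_params n k lam M x" and f: "\<And>\<sigma>. integrable (noisy_entries n lam x \<sigma>) f"
  shows "has_bochner_integral (gaussian_model n k lam M x) f
    (measure_pmf.expectation (labels n k M x) (\<lambda>\<sigma>. \<integral>y. f y \<partial>noisy_entries n lam x \<sigma>))"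
  unfolding gaussian_model_def labels_def[symmetric]
proof (rule has_bochner_integral_bind_pmf)
  show "finite (set_pmf (labels n k M x))" by (rule finite_set_labels[OF v])
  show "integrable (noisy_entries n lam x \<sigma>) f" for \<sigma> by (rule f)
  show "noisy_entries n lam x \<in> measurable (measure_pmf (labels n k M x))
      (subprob_algebra (\<Pi>\<^sub>M e\<in>entries n. borel))"
    by (rule measurable_prob_algebraD[OF noisy_entries_measurable])
  show "f \<in> borel_measurable (\<Pi>\<^sub>M e\<in>entries n. borel)"
    using borel_measurable_integrable[OF f[of undefined]]
    by (simp add: measurable_cong_sets[OF sets_noisy_entries refl])
qed

section \<open>Deconvolution of moment sequences\<close>

definition mbinom :: "'i set \<Rightarrow> ('i \<Rightarrow> nat) \<Rightarrow> ('i \<Rightarrow> nat) \<Rightarrow> real" where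
  "mbinom E \<alpha> \<beta> = (\<Prod>e\<in>E. real (\<alpha> e choose \<beta> e))"

text \<open>\<open>deconv E m m'\<close> is the sequence whose binomial convolution with \<open>m'\<close> is \<open>m\<close> (if \<open>m' 0 = 1\<close>).\<close>

function deconv :: "'i set \<Rightarrow> (('i \<Rightarrow> nat) \<Rightarrow> real) \<Rightarrow> (('i \<Rightarrow> nat) \<Rightarrow> real) \<Rightarrow> ('i \<Rightarrow> nat) \<Rightarrow> real" where
  "deconv E m m' \<alpha> = m \<alpha> - (\<Sum>\<beta>\<in>{\<beta>. \<beta> \<le> \<alpha> \<and> sum \<beta> E < sum \<alpha> E}.
     mbinom E \<alpha> \<beta> * deconv E m m' \<beta> * m' (\<lambda>e. \<alpha> e - \<beta> e))"
  by auto
termination by (relation "Wellfounded.measure (\<lambda>(E, m, m', \<alpha>). sum \<alpha> E)") auto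

declare deconv.simps [simp del]

lemma mbinom_self: "mbinom E \<alpha> \<alpha> = 1"
  by (simp add: mbinom_def)

lemma sum_less_midx:
  assumes E: "finite E" and "\<alpha> \<in> midx E D" "\<beta> \<le> \<alpha>" "\<beta> \<noteq> \<alpha>"
  shows "sum \<beta> E < sum \<alpha> E"
proof -
  have le: "\<beta> e \<le> \<alpha> e" for e using assms by (simp add: le_fun_def)
  obtain e where e: "\<beta> e \<noteq> \<alpha> e" using assms by auto
  have "e \<in> E" using e le[of e] assms(2) by (force simp: midx_def)
  then show ?thesis
    using e le by (intro sum_strict_mono_ex1[OF E]) (auto intro!: bexI[of _ e] simp: order.strict_iff_order)
qed

text \<open>The recursion for \<open>deconv\<close> descends in total degree, which makes
  termination immediate; on multi-indices this range is the down-set without its top.\<close>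

lemma less_midx_eq:
  assumes "finite E" "\<alpha> \<in> midx E D"
  shows "{\<beta>. \<beta> \<le> \<alpha> \<and> sum \<beta> E < sum \<alpha> E} = {..\<alpha>} - {\<alpha>}"
  using sum_less_midx[OF assms] by auto

text \<open>The recursion solved for \<open>m \<alpha>\<close>: the term
  \<open>\<beta> = \<alpha>\<close> of the convolution is \<open>deconv E m m' \<alpha>\<close>
  itself because its weight is \<open>m'\<close> at 0.\<close>

lemma deconv_conv:
  assumes "finite E" "\<alpha> \<in> midx E D" "m' (\<lambda>_. 0) = 1"
  shows "m \<alpha> = (\<Sum>\<beta>\<le>\<alpha>. mbinom E \<alpha> \<beta> * deconv E m m' \<beta> * m' (\<lambda>e. \<alpha> e - \<beta> e))"
proof -
  have "(\<Sum>\<beta>\<le>\<alpha>. mbinom E \<alpha> \<beta> * deconv E m m' \<beta> * m' (\<lambda>e. \<alpha> e - \<beta> e))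
      = deconv E m m' \<alpha> + (\<Sum>\<beta>\<in>{..\<alpha>} - {\<alpha>}. mbinom E \<alpha> \<beta> * deconv E m m' \<beta> * m' (\<lambda>e. \<alpha> e - \<beta> e))"
    using finite_atMost_midx[OF assms(1,2)] by (subst sum.remove[of _ \<alpha>]) (auto simp: mbinom_self assms(3))
  also have "\<dots> = m \<alpha>"
    by (subst deconv.simps) (simp add: less_midx_eq[OF assms(1,2)])
  finally show ?thesis ..
qed

lemma sum_mbinom_power:
  fixes A :: real
  assumes "finite E" "\<alpha> \<in> midx E D"
  shows "(\<Sum>\<beta>\<le>\<alpha>. mbinom E \<alpha> \<beta> * A ^ sum \<beta> E) = (A + 1) ^ sum \<alpha> E"
proof -
  have "(A + 1) ^ sum \<alpha> E = (\<Prod>e\<in>E. \<Sum>j\<le>\<alpha> e. real (\<alpha> e choose j) * A ^ j)"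
    by (simp add: power_sum binomial_ring)
  also have "\<dots> = (\<Sum>\<beta>\<le>\<alpha>. \<Prod>e\<in>E. real (\<alpha> e choose \<beta> e) * A ^ \<beta> e)"
    by (rule prod_sum_atMost) (use assms in \<open>auto simp: midx_def\<close>)
  also have "\<dots> = (\<Sum>\<beta>\<le>\<alpha>. mbinom E \<alpha> \<beta> * A ^ sum \<beta> E)"
    by (simp add: mbinom_def prod.distrib power_sum)
  finally show ?thesis ..
qed

text \<open>This inequality closes the induction for the size of \<open>deconv\<close>. For
  \<open>A \<ge> 4 * d\<close> one has \<open>(1 + 1 / A) ^ d \<le> 3 / 2\<close>, and the remaining
  1 is at most half of \<open>A ^ d\<close>.\<close>

lemma power_Suc_le_twice:
  fixes A :: real
  assumes "4 * real d \<le> A" "1 \<le> d"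
  shows "1 + (A + 1) ^ d \<le> 2 * A ^ d"
proof -
  have A: "4 \<le> A" using assms by linarith
  \<comment> \<open>This is \<open>(1 + 1 / A) ^ j \<le> 1 + 2 * j / A\<close> with denominators
    cleared; the slack factor 2 absorbs the second-order term of the induction.\<close>
  have *: "A * (A + 1) ^ j \<le> A ^ j * (A + 2 * real j)" if "j \<le> d" for j
    using that
  proof (induction j)
    case (Suc j)
    have j: "2 * real j \<le> A" using Suc.prems assms by linarith
    have "A * (A + 1) ^ Suc j \<le> A ^ j * (A + 2 * real j) * (A + 1)"
      using mult_right_mono[OF Suc.IH, of "A + 1"] Suc.prems A by (simp add: mult_ac)
    also have "\<dots> = A ^ j * ((A + 2 * real j) * (A + 1))" by simp
    also have "\<dots> \<le> A ^ j * (A * (A + 2 * real (Suc j)))"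
      using A j by (intro mult_left_mono) (auto simp: algebra_simps)
    finally show ?case by (simp add: mult_ac)
  qed simp
  have "A * (A + 1) ^ d \<le> A ^ d * (A + 2 * real d)" by (rule *) simp
  also have "\<dots> \<le> A ^ d * (A * (3 / 2))"
    using A assms by (intro mult_left_mono) auto
  finally have "A * (A + 1) ^ d \<le> A * (A ^ d * (3 / 2))" by (simp add: mult_ac)
  then have 1: "(A + 1) ^ d \<le> A ^ d * (3 / 2)" using A by simp
  have "A ^ 1 \<le> A ^ d" using A assms by (intro power_increasing) auto
  with 1 A show ?thesis by simp
qed

text \<open>The weight \<open>K ^ d * q ^ v\<close> passes through the recursion: degrees add up,
  and \<open>v\<close> is subadditive while \<open>q \<le> 1\<close>. Only the growth in the number
  of terms remains, and it costs a factor \<open>4 * D\<close> per degree.\<close>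

lemma deconv_bound:
  fixes v :: "('i \<Rightarrow> nat) \<Rightarrow> nat"
  assumes E: "finite E" and q: "0 \<le> q" "q \<le> 1" and K: "0 \<le> K"
    and m: "\<And>\<alpha>. \<bar>m \<alpha>\<bar> \<le> K ^ sum \<alpha> E * q ^ v \<alpha>"
    and m': "\<And>\<alpha>. \<bar>m' \<alpha>\<bar> \<le> K ^ sum \<alpha> E * q ^ v \<alpha>"
    and v: "\<And>\<alpha> \<beta>. \<beta> \<le> \<alpha> \<Longrightarrow> v \<alpha> \<le> v \<beta> + v (\<lambda>e. \<alpha> e - \<beta> e)"
    and \<alpha>: "\<alpha> \<in> midx E D"
  shows "\<bar>deconv E m m' \<alpha>\<bar> \<le> (4 * real D) ^ sum \<alpha> E * K ^ sum \<alpha> E * q ^ v \<alpha>"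
  using \<alpha>
proof (induction "sum \<alpha> E" arbitrary: \<alpha> rule: less_induct)
  case less
  let ?A = "4 * real D" and ?d = "sum \<alpha> E"
  let ?B = "{..\<alpha>} - {\<alpha>}"
  show ?case
  proof (cases "?d = 0")
    case True
    then have "deconv E m m' \<alpha> = m \<alpha>" by (subst deconv.simps) simp
    then show ?thesis using m[of \<alpha>] True by simp
  next
    case False
    have tm: "\<bar>mbinom E \<alpha> \<beta> * deconv E m m' \<beta> * m' (\<lambda>e. \<alpha> e - \<beta> e)\<bar>
        \<le> (mbinom E \<alpha> \<beta> * ?A ^ sum \<beta> E) * (K ^ ?d * q ^ v \<alpha>)" if "\<beta> \<in> ?B" for \<beta>
    proof -
      have b: "\<beta> \<le> \<alpha>" "sum \<beta> E < ?d" using that sum_less_midx[OF E less.prems] by auto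
      have "?d = sum \<beta> E + sum (\<lambda>e. \<alpha> e - \<beta> e) E"
        using b(1) by (simp add: sum.distrib[symmetric] le_fun_def)
      then have K': "K ^ ?d = K ^ sum \<beta> E * K ^ sum (\<lambda>e. \<alpha> e - \<beta> e) E" by (simp add: power_add)
      have q': "q ^ v \<beta> * q ^ v (\<lambda>e. \<alpha> e - \<beta> e) \<le> q ^ v \<alpha>"
        unfolding power_add[symmetric] using v[OF b(1)] q by (intro power_decreasing)
      have "\<bar>deconv E m m' \<beta>\<bar> * \<bar>m' (\<lambda>e. \<alpha> e - \<beta> e)\<bar>
          \<le> (?A ^ sum \<beta> E * K ^ sum \<beta> E * q ^ v \<beta>) * (K ^ sum (\<lambda>e. \<alpha> e - \<beta> e) E * q ^ v (\<lambda>e. \<alpha> e - \<beta> e))"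
        by (intro mult_mono less.hyps[OF b(2)] midx_mono[OF b(1) less.prems] m')
           (use K q in auto)
      also have "\<dots> = (?A ^ sum \<beta> E * K ^ ?d) * (q ^ v \<beta> * q ^ v (\<lambda>e. \<alpha> e - \<beta> e))"
        unfolding K' by simp
      also have "\<dots> \<le> (?A ^ sum \<beta> E * K ^ ?d) * q ^ v \<alpha>"
        using K by (intro mult_left_mono[OF q']) auto
      finally have "mbinom E \<alpha> \<beta> * (\<bar>deconv E m m' \<beta>\<bar> * \<bar>m' (\<lambda>e. \<alpha> e - \<beta> e)\<bar>)
          \<le> mbinom E \<alpha> \<beta> * ((?A ^ sum \<beta> E * K ^ ?d) * q ^ v \<alpha>)"
        by (intro mult_left_mono) (auto simp: mbinom_def intro: prod_nonneg)
      moreover have "\<bar>mbinom E \<alpha> \<beta>\<bar> = mbinom E \<alpha> \<beta>"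
        by (simp add: mbinom_def prod_nonneg)
      ultimately show ?thesis by (simp add: abs_mult mult_ac)
    qed
    have "(\<Sum>\<beta>\<in>?B. mbinom E \<alpha> \<beta> * ?A ^ sum \<beta> E) = (?A + 1) ^ ?d - ?A ^ ?d"
      unfolding sum_mbinom_power[OF E less.prems, symmetric]
      by (subst sum.remove[of _ \<alpha>]) (auto simp: mbinom_self finite_atMost_midx[OF E less.prems])
    note S = this
    have "\<bar>deconv E m m' \<alpha>\<bar> \<le> \<bar>m \<alpha>\<bar> + \<bar>\<Sum>\<beta>\<in>?B. mbinom E \<alpha> \<beta> * deconv E m m' \<beta> * m' (\<lambda>e. \<alpha> e - \<beta> e)\<bar>"
      by (subst deconv.simps) (simp add: less_midx_eq[OF E less.prems] abs_triangle_ineq4)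
    also have "\<dots> \<le> K ^ ?d * q ^ v \<alpha> + (\<Sum>\<beta>\<in>?B. (mbinom E \<alpha> \<beta> * ?A ^ sum \<beta> E) * (K ^ ?d * q ^ v \<alpha>))"
      by (intro add_mono m order_trans[OF sum_abs] sum_mono tm)
    also have "\<dots> = (1 + (?A + 1) ^ ?d - ?A ^ ?d) * (K ^ ?d * q ^ v \<alpha>)"
      unfolding sum_distrib_right[symmetric] S by (simp add: algebra_simps)
    \<comment> \<open>By the binomial theorem the lower-order terms sum to
      \<open>(A + 1) ^ d - A ^ d\<close>. The choice \<open>A = 4 * D\<close> makes this plus 1 at
      most \<open>A ^ d\<close>, uniformly for degrees up to \<open>D\<close>.\<close>
    also have "\<dots> \<le> ?A ^ ?d * (K ^ ?d * q ^ v \<alpha>)"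
    proof (rule mult_right_mono)
      have "4 * real ?d \<le> ?A" using less.prems by (simp add: midx_def del: of_nat_sum)
      then show "1 + (?A + 1) ^ ?d - ?A ^ ?d \<le> ?A ^ ?d"
        using power_Suc_le_twice[of ?d ?A] False by linarith
    qed (use K q in auto)
    finally show ?thesis by (simp add: mult_ac)
  qed
qed

definition restr :: "'i set \<Rightarrow> ('i \<Rightarrow> nat) \<Rightarrow> 'i \<Rightarrow> nat" where
  "restr F \<alpha> = (\<lambda>e. if e \<in> F then \<alpha> e else 0)"

text \<open>The generating functions factorise along \<open>F\<close> and their \<open>F\<close>-factors cancel in the quotient,
  which therefore does not involve the variables in \<open>F\<close>.\<close>

lemma deconv_eq_0:
  assumes E: "finite E" and \<alpha>: "\<alpha> \<in> midx E D" and 1: "m' (\<lambda>_. 0) = 1"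
    and mult: "\<And>\<beta>. \<beta> \<le> \<alpha> \<Longrightarrow> m \<beta> = m (restr F \<beta>) * m (restr (- F) \<beta>)"
    and mult': "\<And>\<beta>. \<beta> \<le> \<alpha> \<Longrightarrow> m' \<beta> = m' (restr F \<beta>) * m' (restr (- F) \<beta>)"
    and agree: "\<And>\<beta>. \<beta> \<le> \<alpha> \<Longrightarrow> m (restr F \<beta>) = m' (restr F \<beta>)"
    and nz: "restr F \<alpha> \<noteq> (\<lambda>_. 0)"
  shows "deconv E m m' \<alpha> = 0"
proof -
  have "deconv E m m' \<gamma> = 0" if "\<gamma> \<le> \<alpha>" "restr F \<gamma> \<noteq> (\<lambda>_. 0)" for \<gamma>
    using that
  proof (induction "sum \<gamma> E" arbitrary: \<gamma> rule: less_induct)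
    case less
    have \<gamma>: "\<gamma> \<in> midx E D" using midx_mono[OF less.prems(1) \<alpha>] .
    let ?G = "restr (- F) \<gamma>"
    let ?t = "\<lambda>\<beta>. mbinom E \<gamma> \<beta> * deconv E m m' \<beta> * m' (\<lambda>e. \<gamma> e - \<beta> e)"
    have G: "?G \<le> \<gamma>" by (simp add: restr_def le_fun_def)
    have fin: "finite {..\<gamma>}" by (rule finite_atMost_midx[OF E \<gamma>])
    have ne: "\<gamma> \<notin> {..?G}"
      using less.prems(2) by (auto simp: restr_def le_fun_def fun_eq_iff split: if_splits)
    \<comment> \<open>By induction every \<open>\<beta>\<close> strictly below
      \<open>\<gamma>\<close> that meets \<open>F\<close> contributes nothing. What survives is the
      top term and the \<open>\<beta>\<close> living outside \<open>F\<close>.\<close>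
    have "m \<gamma> = (\<Sum>\<beta>\<in>insert \<gamma> {..?G}. ?t \<beta>)"
      unfolding deconv_conv[where m = m and m' = m', OF E \<gamma> 1]
    proof (rule sum.mono_neutral_right[OF fin])
      show "insert \<gamma> {..?G} \<subseteq> {..\<gamma>}" using G by (auto intro: order_trans)
      show "\<forall>\<beta>\<in>{..\<gamma>} - insert \<gamma> {..?G}. ?t \<beta> = 0"
      proof
        fix \<beta> assume b: "\<beta> \<in> {..\<gamma>} - insert \<gamma> {..?G}"
        then have "restr F \<beta> \<noteq> (\<lambda>_. 0)"
          by (auto simp: restr_def le_fun_def fun_eq_iff split: if_splits)
        then have "deconv E m m' \<beta> = 0"
          using b less.prems by (intro less.hyps sum_less_midx[OF E \<gamma>]) (auto intro: order_trans)
        then show "?t \<beta> = 0" by simp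
      qed
    qed
    also have "\<dots> = deconv E m m' \<gamma> + (\<Sum>\<beta>\<le>?G. ?t \<beta>)"
      using ne finite_subset[OF _ fin, of "{..?G}"] G by (subst sum.insert) (auto simp: mbinom_self 1 intro: order_trans)
    also have "(\<Sum>\<beta>\<le>?G. ?t \<beta>)
        = (\<Sum>\<beta>\<le>?G. m' (restr F \<gamma>) * (mbinom E ?G \<beta> * deconv E m m' \<beta> * m' (\<lambda>e. ?G e - \<beta> e)))"
    proof (rule sum.cong[OF refl])
      fix \<beta> assume "\<beta> \<in> {..?G}"
      then have b: "\<beta> e \<le> ?G e" for e by (simp add: le_fun_def)
      have b0: "\<beta> e = 0" if "e \<in> F" for e using b[of e] that by (simp add: restr_def)
      have "mbinom E \<gamma> \<beta> = mbinom E ?G \<beta>"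
        unfolding mbinom_def by (intro prod.cong) (auto simp: restr_def b0)
      moreover have "restr F (\<lambda>e. \<gamma> e - \<beta> e) = restr F \<gamma>" "restr (- F) (\<lambda>e. \<gamma> e - \<beta> e) = (\<lambda>e. ?G e - \<beta> e)"
        by (auto simp: restr_def b0)
      moreover have "m' (\<lambda>e. \<gamma> e - \<beta> e)
          = m' (restr F (\<lambda>e. \<gamma> e - \<beta> e)) * m' (restr (- F) (\<lambda>e. \<gamma> e - \<beta> e))"
        using less.prems(1) by (intro mult') (auto simp: le_fun_def intro: order_trans[OF diff_le_self])
      ultimately show "?t \<beta> = m' (restr F \<gamma>) * (mbinom E ?G \<beta> * deconv E m m' \<beta> * m' (\<lambda>e. ?G e - \<beta> e))"
        by simp
    qed
    \<comment> \<open>The remaining sum is the full convolution for the part outside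
      \<open>F\<close>, so it returns \<open>m ?G\<close>. Since the \<open>F\<close>-factors of
      \<open>m\<close> and \<open>m'\<close> agree, this already equals \<open>m \<gamma>\<close>,
      and the top term must be 0.\<close>
    also have "\<dots> = m' (restr F \<gamma>) * m ?G"
      unfolding sum_distrib_left[symmetric]
      unfolding deconv_conv[where m = m and m' = m', OF E midx_mono[OF G \<gamma>] 1] ..
    also have "\<dots> = m \<gamma>" using mult[OF less.prems(1)] agree[OF less.prems(1)] by simp
    finally show ?case by simp
  qed
  with nz show ?thesis by blast
qed

text \<open>An exponent vector of degree \<open>d\<close> arises from 0 by \<open>d\<close> unit
  increments with \<open>card F\<close> choices each; the overcounting is harmless.\<close>

lemma card_exact_degree:
  assumes "finite F"
  shows "finite {\<alpha>::'i \<Rightarrow> nat. (\<forall>e. e \<notin> F \<longrightarrow> \<alpha> e = 0) \<and> sum \<alpha> F = d}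
    \<and> card {\<alpha>::'i \<Rightarrow> nat. (\<forall>e. e \<notin> F \<longrightarrow> \<alpha> e = 0) \<and> sum \<alpha> F = d} \<le> card F ^ d"
proof (induction d)
  case 0
  have "{\<alpha>::'i \<Rightarrow> nat. (\<forall>e. e \<notin> F \<longrightarrow> \<alpha> e = 0) \<and> sum \<alpha> F = 0} \<subseteq> {\<lambda>_. 0}"
    using assms by (auto simp: fun_eq_iff)
  from finite_subset[OF this] card_mono[OF _ this] show ?case by simp
next
  case (Suc d)
  let ?S = "\<lambda>d. {\<alpha>::'i \<Rightarrow> nat. (\<forall>e. e \<notin> F \<longrightarrow> \<alpha> e = 0) \<and> sum \<alpha> F = d}"
  have "?S (Suc d) \<subseteq> (\<lambda>(e, \<alpha>). \<alpha>(e := Suc (\<alpha> e))) ` (F \<times> ?S d)"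
  proof
    fix \<alpha> assume a: "\<alpha> \<in> ?S (Suc d)"
    then obtain e where e: "e \<in> F" "\<alpha> e \<noteq> 0" by (metis (mono_tags, lifting) mem_Collect_eq nat.distinct(1) sum.neutral)
    have "sum \<alpha> F = \<alpha> e + sum \<alpha> (F - {e})" using assms e by (intro sum.remove)
    moreover have "sum (\<alpha>(e := \<alpha> e - 1)) F = (\<alpha> e - 1) + sum \<alpha> (F - {e})"
      using assms e by (subst sum.remove[of _ e]) auto
    ultimately have "\<alpha>(e := \<alpha> e - 1) \<in> ?S d" using a e by auto
    moreover have "\<alpha> = (\<lambda>(e, \<alpha>). \<alpha>(e := Suc (\<alpha> e))) (e, \<alpha>(e := \<alpha> e - 1))" using e by auto
    ultimately show "\<alpha> \<in> (\<lambda>(e, \<alpha>). \<alpha>(e := Suc (\<alpha> e))) ` (F \<times> ?S d)" using e by (intro image_eqI) auto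
  qed
  moreover have fin: "finite (F \<times> ?S d)" using Suc assms by simp
  ultimately have "finite (?S (Suc d))" "card (?S (Suc d)) \<le> card (F \<times> ?S d)"
    by (auto intro: finite_subset order_trans[OF card_mono card_image_le])
  moreover have "card (F \<times> ?S d) \<le> card F ^ Suc d" using Suc by (simp add: card_cartesian_product)
  ultimately show ?case by linarith
qed

section \<open>Moments of the signal as multigraph statistics\<close>

definition vset :: "nat \<Rightarrow> (nat \<times> nat \<Rightarrow> nat) \<Rightarrow> nat set" where
  "vset n \<alpha> = {v. \<exists>e\<in>entries n. 0 < \<alpha> e \<and> (v = fst e \<or> v = snd e)}"

definition edges_in :: "nat \<Rightarrow> nat set \<Rightarrow> (nat \<times> nat) set" where
  "edges_in n S = {e \<in> entries n. fst e \<in> S \<and> snd e \<in> S}"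

text \<open>A nonempty multigraph without cycles has fewer edges than vertices; demanding this of all
  submultigraphs characterises forests.\<close>

definition forest :: "nat \<Rightarrow> (nat \<times> nat \<Rightarrow> nat) \<Rightarrow> bool" where
  "forest n \<alpha> \<longleftrightarrow> (\<forall>\<beta>\<le>\<alpha>. vset n \<beta> \<noteq> {} \<longrightarrow> sum \<beta> (entries n) < card (vset n \<beta>))"

lemma vset_subset: "vset n \<alpha> \<subseteq> {1..n}"
  by (auto simp: vset_def entries_def)

lemma finite_vset: "finite (vset n \<alpha>)"
  by (rule finite_subset[OF vset_subset]) simp

lemma vset_empty_iff: "vset n \<alpha> = {} \<longleftrightarrow> (\<forall>e\<in>entries n. \<alpha> e = 0)"
  by (fastforce simp: vset_def)

lemma finite_edges_in: "finite (edges_in n S)"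
  by (rule finite_subset[OF _ finite_entries[of n]]) (auto simp: edges_in_def)

lemma forest_mono: "forest n \<alpha> \<Longrightarrow> \<beta> \<le> \<alpha> \<Longrightarrow> forest n \<beta>"
  unfolding forest_def by (blast intro: order_trans)

text \<open>Handshake argument: the degrees sum to twice the number of edges, hence to less than
  twice the number of vertices, so some vertex has degree below 2.\<close>

lemma ex_leaf:
  assumes "vset n \<alpha> \<noteq> {}" and less: "sum \<alpha> (entries n) < card (vset n \<alpha>)"
  obtains e u v where "e \<in> entries n" "\<alpha> e = 1" "u \<noteq> v" "e = (u, v) \<or> e = (v, u)"
    "\<And>e'. e' \<in> entries n \<Longrightarrow> e' \<noteq> e \<Longrightarrow> 0 < \<alpha> e' \<Longrightarrow> fst e' \<noteq> v \<and> snd e' \<noteq> v"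
proof -
  \<comment> \<open>A loop counts twice. A vertex of degree 1 therefore carries no loop, and its
    only edge has multiplicity 1.\<close>
  define dg where "dg v e = \<alpha> e * (of_bool (fst e = v) + of_bool (snd e = v))" for v and e :: "nat \<times> nat"
  have "(\<Sum>v\<in>vset n \<alpha>. \<Sum>e\<in>entries n. dg v e) = (\<Sum>e\<in>entries n. \<Sum>v\<in>vset n \<alpha>. dg v e)"
    by (rule sum.swap)
  also have "\<dots> = (\<Sum>e\<in>entries n. 2 * \<alpha> e)"
  proof (rule sum.cong[OF refl])
    fix e assume e: "e \<in> entries n"
    show "(\<Sum>v\<in>vset n \<alpha>. dg v e) = 2 * \<alpha> e"
    proof (cases "\<alpha> e = 0")
      case False
      then have "fst e \<in> vset n \<alpha>" "snd e \<in> vset n \<alpha>" using e by (auto simp: vset_def)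
      then show ?thesis
        by (simp add: dg_def sum_distrib_left[symmetric] sum.distrib finite_vset of_bool_def sum.delta)
    qed (simp add: dg_def)
  qed
  finally have "(\<Sum>v\<in>vset n \<alpha>. \<Sum>e\<in>entries n. dg v e) < 2 * card (vset n \<alpha>)"
    using less by (simp add: sum_distrib_left[symmetric])
  then have "\<exists>v\<in>vset n \<alpha>. (\<Sum>e\<in>entries n. dg v e) < 2"
    using sum_bounded_below[of "vset n \<alpha>" 2 "\<lambda>v. \<Sum>e\<in>entries n. dg v e"] by (force simp: not_less)
  then obtain v where v: "v \<in> vset n \<alpha>" "(\<Sum>e\<in>entries n. dg v e) < 2" by blast
  then obtain e where e: "e \<in> entries n" "0 < \<alpha> e" "v = fst e \<or> v = snd e" by (auto simp: vset_def)
  have s: "dg v e + sum (dg v) (entries n - {e}) < 2"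
    using v(2) sum.remove[OF finite_entries e(1), of "dg v"] by simp
  have ge: "\<alpha> e \<le> dg v e" using e by (auto simp: dg_def)
  have \<alpha>e: "\<alpha> e = 1" and rest: "sum (dg v) (entries n - {e}) = 0" using s ge e by linarith+
  have "fst e \<noteq> snd e" using s e \<alpha>e by (auto simp: dg_def)
  have out: "fst e' \<noteq> v \<and> snd e' \<noteq> v" if "e' \<in> entries n" "e' \<noteq> e" "0 < \<alpha> e'" for e'
  proof -
    have "dg v e' = 0" using rest that finite_entries[of n] by auto
    then show ?thesis using that by (auto simp: dg_def)
  qed
  show ?thesis
  proof (cases "v = fst e")
    case True
    show ?thesis
      by (rule that[of e "snd e" v]) (use e \<alpha>e out \<open>fst e \<noteq> snd e\<close> True in auto)
  next
    case False
    then show ?thesis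
      by (intro that[of e "fst e" v]) (use e \<alpha>e out \<open>fst e \<noteq> snd e\<close> in auto)
  qed
qed

text \<open>\<open>S\<close> is the complement of a maximal vertex set \<open>T\<close> spanning at least \<open>card T\<close> edges. Maximality
  makes \<open>T\<close> closed under adjacency, and a cycle inside \<open>S\<close> could be added to \<open>T\<close>.\<close>

lemma ex_forest_part:
  assumes less: "sum \<alpha> (entries n) < card (vset n \<alpha>)"
  obtains S where "S \<subseteq> {1..n}" "restr (edges_in n S) \<alpha> \<noteq> (\<lambda>_. 0)" "forest n (restr (edges_in n S) \<alpha>)"
    "\<And>e. e \<in> entries n \<Longrightarrow> 0 < \<alpha> e \<Longrightarrow> fst e \<in> S \<longleftrightarrow> snd e \<in> S"
proof -
  let ?V = "vset n \<alpha>"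
  define w where "w U = sum \<alpha> (edges_in n U)" for U
  define \<T> where "\<T> = {T. T \<subseteq> ?V \<and> card T \<le> w T}"
  have "finite \<T>" by (rule finite_subset[of _ "Pow ?V"]) (auto simp: \<T>_def finite_vset)
  moreover have "\<T> \<noteq> {}" by (auto simp: \<T>_def intro!: exI[of _ "{}"])
  ultimately obtain T where T: "T \<in> \<T>" and max: "\<And>U. U \<in> \<T> \<Longrightarrow> T \<subseteq> U \<Longrightarrow> T = U"
    using finite_has_maximal[of \<T>] by metis
  have TV: "T \<subseteq> ?V" and Tw: "card T \<le> w T" using T by (auto simp: \<T>_def)
  have finT: "finite T" using TV finite_vset finite_subset by blast
  define S where "S = ?V - T"
  have closed: "b \<in> T" if e: "e \<in> entries n" "0 < \<alpha> e" and ab: "e = (a, b) \<or> e = (b, a)" "a \<in> T" for e a b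
  proof (rule ccontr)
    assume b: "b \<notin> T"
    have "b \<in> ?V" using e ab by (force simp: vset_def)
    \<comment> \<open>Adding \<open>b\<close> costs one vertex and gains at least the edge
      \<open>e\<close>, so the larger set would again belong to \<open>\<T>\<close>.\<close>
    have "insert e (edges_in n T) \<subseteq> edges_in n (insert b T)" "e \<notin> edges_in n T"
      using e ab b by (auto simp: edges_in_def)
    then have "sum \<alpha> (insert e (edges_in n T)) = \<alpha> e + w T"
      and "sum \<alpha> (insert e (edges_in n T)) \<le> w (insert b T)"
      unfolding w_def by (simp add: finite_edges_in, intro sum_mono2) (auto simp: finite_edges_in)
    then have "\<alpha> e + w T \<le> w (insert b T)" by simp
    then have "insert b T \<in> \<T>" using e b Tw TV \<open>b \<in> ?V\<close> finT by (auto simp: \<T>_def)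
    from max[OF this] b show False by auto
  qed
  have both: "fst e \<in> S \<longleftrightarrow> snd e \<in> S" if e: "e \<in> entries n" "0 < \<alpha> e" for e
  proof -
    have "fst e \<in> ?V" "snd e \<in> ?V" using e by (auto simp: vset_def)
    moreover have "fst e \<in> T \<longleftrightarrow> snd e \<in> T"
      using closed[OF e, of "fst e" "snd e"] closed[OF e, of "snd e" "fst e"] by auto
    ultimately show ?thesis by (simp add: S_def)
  qed
  have "w ?V \<le> sum \<alpha> (entries n)"
    unfolding w_def by (rule sum_mono2) (auto simp: finite_entries edges_in_def)
  then have "T \<noteq> ?V" using Tw less by auto
  then obtain s where s: "s \<in> S" using TV by (auto simp: S_def)
  then obtain e where e: "e \<in> entries n" "0 < \<alpha> e" "s = fst e \<or> s = snd e" by (auto simp: S_def vset_def)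
  have eS: "e \<in> edges_in n S" using both[OF e(1,2)] e s by (auto simp: edges_in_def)
  have nz: "restr (edges_in n S) \<alpha> \<noteq> (\<lambda>_. 0)"
  proof
    assume "restr (edges_in n S) \<alpha> = (\<lambda>_. 0)"
    then have "restr (edges_in n S) \<alpha> e = 0" by simp
    then show False using eS e by (simp add: restr_def)
  qed
  have forest: "forest n (restr (edges_in n S) \<alpha>)"
    unfolding forest_def
  proof (intro allI impI)
    fix \<beta> assume \<beta>: "\<beta> \<le> restr (edges_in n S) \<alpha>" and ne: "vset n \<beta> \<noteq> {}"
    let ?U = "vset n \<beta>"
    have \<beta>e: "\<beta> e \<le> \<alpha> e" "e \<notin> edges_in n S \<Longrightarrow> \<beta> e = 0" for e
      using le_funD[OF \<beta>, of e] by (auto simp: restr_def split: if_splits)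
    have US: "?U \<subseteq> S"
    proof
      fix u assume "u \<in> vset n \<beta>"
      then obtain e where e: "0 < \<beta> e" "u = fst e \<or> u = snd e" by (auto simp: vset_def)
      then have "e \<in> edges_in n S" using \<beta>e(2)[of e] by auto
      then show "u \<in> S" using e by (auto simp: edges_in_def)
    qed
    show "sum \<beta> (entries n) < card ?U"
    proof (rule ccontr)
      assume "\<not> ?thesis"
      moreover have "sum \<beta> (entries n) = sum \<beta> (edges_in n ?U)"
        by (rule sum.mono_neutral_right) (auto simp: finite_entries edges_in_def vset_def)
      moreover have "sum \<beta> (edges_in n ?U) \<le> w ?U" unfolding w_def by (rule sum_mono) (rule \<beta>e)
      ultimately have U: "card ?U \<le> w ?U" by linarith
      have disj: "edges_in n T \<inter> edges_in n ?U = {}" using US by (auto simp: edges_in_def S_def)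
      \<comment> \<open>Edges inside \<open>T\<close> and inside \<open>?U\<close> are different
        edges, while the vertex counts of these disjoint sets add; the union satisfies the
        inequality defining \<open>\<T>\<close> as well.\<close>
      have "w T + w ?U \<le> w (T \<union> ?U)"
        unfolding w_def by (subst sum.union_disjoint[symmetric, OF _ _ disj])
          (auto simp: finite_edges_in intro!: sum_mono2, auto simp: edges_in_def)
      moreover have "card (T \<union> ?U) = card T + card ?U"
        using US finT by (intro card_Un_disjoint) (auto simp: S_def finite_vset)
      ultimately have "T \<union> ?U \<in> \<T>" using Tw U US TV by (auto simp: \<T>_def S_def)
      from max[OF this] ne US show False by (auto simp: S_def)
    qed
  qed
  show ?thesis
    by (rule that[OF _ nz forest both]) (use vset_subset S_def in auto)
qed

section \<open>Moments of the signal: bounds, leaf removal, factorisation\<close>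

text \<open>The extra factor for \<open>W\<close> makes removal of a leaf exact: averaging over the label of the leaf
  leaves behind the indicator that its neighbour belongs to some community.\<close>

definition moment ::
  "nat \<Rightarrow> real \<Rightarrow> real \<Rightarrow> nat \<Rightarrow> (nat \<Rightarrow> real) \<Rightarrow> nat set \<Rightarrow> (nat \<times> nat \<Rightarrow> nat) \<Rightarrow> real" where
  "moment n k lam M x W \<alpha> = measure_pmf.expectation (labels n k M x)
     (\<lambda>\<sigma>. (\<Prod>e\<in>entries n. signal lam x \<sigma> e ^ \<alpha> e) * (\<Prod>w\<in>W. of_bool (\<sigma> w \<noteq> None)))"

lemma expectation_label:
  fixes f :: "_ \<Rightarrow> real"
  assumes v: "valid_params n k lam M x"
  shows "measure_pmf.expectation (label_pmf n k M x) f
    = (1 - k / real n) * f None + (\<Sum>l\<in>{1..M}. x l * k / real n * f (Some l))"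
proof -
  have "measure_pmf.expectation (label_pmf n k M x) f
      = (\<Sum>s\<in>insert None (Some ` {1..M}). pmf (label_pmf n k M x) s *\<^sub>R f s)"
    by (rule integral_measure_pmf) (use set_label_pmf[OF v] in auto)
  also have "\<dots> = (1 - k / real n) * f None + (\<Sum>l\<in>{1..M}. x l * k / real n * f (Some l))"
    by (subst sum.insert) (auto simp: sum.reindex pmf_label_pmf[OF v])
  finally show ?thesis .
qed

lemma set_labels:
  assumes v: "valid_params n k lam M x" and "\<sigma> \<in> set_pmf (labels n k M x)"
  shows "\<sigma> i \<in> insert None (Some ` {1..M})"
proof -
  have "\<sigma> \<in> PiE_dflt {1..n} None (set_pmf \<circ> (\<lambda>_. label_pmf n k M x))"
    using assms by (simp add: labels_def set_Pi_pmf)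
  then show ?thesis using set_label_pmf[OF v] by (cases "i \<in> {1..n}") (auto simp: PiE_dflt_def)
qed

lemma integrable_labels:
  assumes "valid_params n k lam M x"
  shows "integrable (measure_pmf (labels n k M x)) (f :: _ \<Rightarrow> real)"
  by (rule integrable_measure_pmf_finite[OF finite_set_labels[OF assms]])

lemma expectation_label_Some:
  assumes v: "valid_params n k lam M x"
  shows "measure_pmf.expectation (label_pmf n k M x) (\<lambda>s. of_bool (s \<noteq> None)) = k / real n"
  using v by (subst expectation_label[OF v])
    (simp add: valid_params_def sum_divide_distrib[symmetric] sum_distrib_right[symmetric])

lemma expectation_prod_Some:
  assumes v: "valid_params n k lam M x" and W: "W \<subseteq> {1..n}"
  shows "measure_pmf.expectation (labels n k M x) (\<lambda>\<sigma>. \<Prod>w\<in>W. of_bool (\<sigma> w \<noteq> None)) = (k / real n) ^ card W"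
proof -
  let ?f = "\<lambda>w s. if w \<in> W then of_bool (s \<noteq> None) else (1 :: real)"
  have p: "(\<Prod>w\<in>W. g w) = (\<Prod>w\<in>{1..n}. if w \<in> W then g w else 1)" for g :: "nat \<Rightarrow> real"
    using W by (intro prod.mono_neutral_cong_left) auto
  have "measure_pmf.expectation (labels n k M x) (\<lambda>\<sigma>. \<Prod>w\<in>W. of_bool (\<sigma> w \<noteq> None))
      = measure_pmf.expectation (labels n k M x) (\<lambda>\<sigma>. \<Prod>w\<in>{1..n}. ?f w (\<sigma> w))"
    by (simp only: p)
  also have "\<dots> = (\<Prod>w\<in>{1..n}. measure_pmf.expectation (label_pmf n k M x) (?f w))"
    unfolding labels_def
    by (intro expectation_prod_Pi_pmf integrable_measure_pmf_finite finite_set_label_pmf[OF v]) auto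
  also have "\<dots> = (\<Prod>w\<in>{1..n}. if w \<in> W then k / real n else 1)"
    by (intro prod.cong) (auto simp: expectation_label_Some[OF v] simp del: not_None_eq)
  also have "\<dots> = (k / real n) ^ card W" by (simp only: p[symmetric] prod_constant)
  finally show ?thesis .
qed

lemma moment_zero:
  assumes v: "valid_params n k lam M x" and W: "W \<subseteq> {1..n}" and \<alpha>: "\<And>e. e \<in> entries n \<Longrightarrow> \<alpha> e = 0"
  shows "moment n k lam M x W \<alpha> = (k / real n) ^ card W"
  unfolding moment_def using expectation_prod_Some[OF v W] by (simp add: \<alpha>)

text \<open>The product of signals vanishes unless every vertex touched by \<open>\<alpha>\<close>
  has a community, an event of probability \<open>(k / n) ^ v\<close>; on it each factor lies
  between 0 and \<open>K\<close>.\<close>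

lemma moment_bound:
  assumes v: "valid_params n k lam M x" and K: "\<And>l. l \<in> {1..M} \<Longrightarrow> lam / x l \<le> K"
  shows "\<bar>moment n k lam M x {} \<alpha>\<bar> \<le> K ^ sum \<alpha> (entries n) * (k / real n) ^ card (vset n \<alpha>)"
proof -
  have x: "0 < lam / x l" if "l \<in> {1..M}" for l using v that by (auto simp: valid_params_def)
  have K0: "0 \<le> K" using order_trans[OF less_imp_le[OF x[of 1]] K[of 1]] v by (auto simp: valid_params_def)
  have sg: "0 \<le> signal lam x \<sigma> e \<and> signal lam x \<sigma> e \<le> K \<and>
      (\<sigma> (fst e) = None \<or> \<sigma> (snd e) = None \<longrightarrow> signal lam x \<sigma> e = 0)"
    if "\<sigma> \<in> set_pmf (labels n k M x)" for \<sigma> e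
    using set_labels[OF v that, of "fst e"] less_imp_le[OF x] K K0
    by (auto simp: signal_def split: prod.split option.split dest: less_imp_le)
  have up: "(\<Prod>e\<in>entries n. signal lam x \<sigma> e ^ \<alpha> e)
      \<le> K ^ sum \<alpha> (entries n) * (\<Prod>w\<in>vset n \<alpha>. of_bool (\<sigma> w \<noteq> None))"
    and lo: "0 \<le> (\<Prod>e\<in>entries n. signal lam x \<sigma> e ^ \<alpha> e)"
    if s: "\<sigma> \<in> set_pmf (labels n k M x)" for \<sigma>
  proof -
    show "0 \<le> (\<Prod>e\<in>entries n. signal lam x \<sigma> e ^ \<alpha> e)" using sg[OF s] by (auto intro!: prod_nonneg)
    show "(\<Prod>e\<in>entries n. signal lam x \<sigma> e ^ \<alpha> e)
      \<le> K ^ sum \<alpha> (entries n) * (\<Prod>w\<in>vset n \<alpha>. of_bool (\<sigma> w \<noteq> None))"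
    proof (cases "\<exists>w\<in>vset n \<alpha>. \<sigma> w = None")
      case True
      then obtain e where e: "e \<in> entries n" "0 < \<alpha> e" "\<sigma> (fst e) = None \<or> \<sigma> (snd e) = None"
        by (auto simp: vset_def)
      then have "(\<Prod>e\<in>entries n. signal lam x \<sigma> e ^ \<alpha> e) = 0"
        using sg[OF s, of e] finite_entries[of n] by (auto simp: prod_zero_iff)
      then show ?thesis using K0 by (auto intro!: mult_nonneg_nonneg prod_nonneg)
    next
      case False
      then have "(\<Prod>w\<in>vset n \<alpha>. of_bool (\<sigma> w \<noteq> None)) = (1::real)" by (intro prod.neutral) auto
      moreover have "(\<Prod>e\<in>entries n. signal lam x \<sigma> e ^ \<alpha> e) \<le> (\<Prod>e\<in>entries n. K ^ \<alpha> e)"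
        by (intro prod_mono) (use sg[OF s] in \<open>auto intro: power_mono\<close>)
      ultimately show ?thesis by (simp add: power_sum)
    qed
  qed
  have "moment n k lam M x {} \<alpha> \<le> measure_pmf.expectation (labels n k M x)
      (\<lambda>\<sigma>. K ^ sum \<alpha> (entries n) * (\<Prod>w\<in>vset n \<alpha>. of_bool (\<sigma> w \<noteq> None)))"
    unfolding moment_def
    by (intro integral_mono_AE integrable_labels[OF v]) (use up in \<open>auto simp: AE_measure_pmf_iff\<close>)
  moreover have "0 \<le> moment n k lam M x {} \<alpha>"
    unfolding moment_def by (intro integral_nonneg_AE) (use lo in \<open>auto simp: AE_measure_pmf_iff\<close>)
  ultimately show ?thesis
    by (simp add: expectation_prod_Some[OF v vset_subset] del: not_None_eq)
qed

text \<open>The leaf label enters through the single edge \<open>e\<close>. Averaging it out gives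
  \<open>lam * k / n\<close> for every community of the neighbour \<open>u\<close> and 0 if
  \<open>u\<close> has none, so all that is left is the indicator for \<open>u\<close>.\<close>

lemma moment_leaf:
  assumes v: "valid_params n k lam M x" and W: "W \<subseteq> {1..n}"
    and e: "e \<in> entries n" "\<alpha> e = 1" and uw: "u \<noteq> w" "e = (u, w) \<or> e = (w, u)"
    and leaf: "\<And>e'. e' \<in> entries n \<Longrightarrow> e' \<noteq> e \<Longrightarrow> 0 < \<alpha> e' \<Longrightarrow> fst e' \<noteq> w \<and> snd e' \<noteq> w"
  shows "moment n k lam M x W \<alpha> = lam * (k / real n) * moment n k lam M x (insert u (W - {w})) (\<alpha>(e := 0))"
proof -
  let ?p = "label_pmf n k M x" and ?L = "labels n k M x"
  have finW: "finite W" using W finite_subset by blast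
  have w: "w \<in> {1..n}" using e uw by (auto simp: entries_def)
  define A where "A \<sigma> = (\<Prod>e'\<in>entries n - {e}. signal lam x \<sigma> e' ^ \<alpha> e')" for \<sigma>
  define B where "B \<sigma> = (\<Prod>i\<in>W - {w}. of_bool (\<sigma> i \<noteq> None) :: real)" for \<sigma> :: "nat \<Rightarrow> nat option"
  define g where "g a s = (case a of None \<Rightarrow> 0 | Some l \<Rightarrow> if s = Some l then lam / x l else 0)"
    for a s :: "nat option"
  have upd: "(\<Prod>e'\<in>entries n. signal lam x (\<sigma>(w := s)) e' ^ \<alpha> e') * (\<Prod>i\<in>W. of_bool ((\<sigma>(w := s)) i \<noteq> None))
      = A \<sigma> * B \<sigma> * g (\<sigma> u) s" for \<sigma> s
  proof -
    have "A (\<sigma>(w := s)) = A \<sigma>"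
      unfolding A_def
    proof (rule prod.cong[OF refl])
      fix e' assume "e' \<in> entries n - {e}"
      then show "signal lam x (\<sigma>(w := s)) e' ^ \<alpha> e' = signal lam x \<sigma> e' ^ \<alpha> e'"
        using leaf[of e'] by (cases "\<alpha> e' = 0") (auto simp: signal_def split: prod.split option.split)
    qed
    moreover have "signal lam x (\<sigma>(w := s)) e = g (\<sigma> u) s"
      using uw by (auto simp: signal_def g_def split: option.split)
    moreover have "g (\<sigma> u) s * (\<Prod>i\<in>W. of_bool ((\<sigma>(w := s)) i \<noteq> None)) = g (\<sigma> u) s * B \<sigma>"
    proof (cases "w \<in> W")
      case True
      have "(\<Prod>i\<in>W. of_bool ((\<sigma>(w := s)) i \<noteq> None) :: real) = of_bool (s \<noteq> None) * B \<sigma>"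
        unfolding B_def by (subst prod.remove[OF finW True]) (auto intro!: prod.cong)
      then show ?thesis by (auto simp: g_def split: option.split)
    next
      case False
      then show ?thesis unfolding B_def by (auto intro!: prod.cong)
    qed
    ultimately show ?thesis
      by (subst prod.remove[OF finite_entries e(1)]) (auto simp: e(2) A_def mult_ac)
  qed
  \<comment> \<open>The decisive cancellation: probability \<open>x l * k / n\<close> times signal
    \<open>lam / x l\<close> no longer depends on \<open>l\<close>.\<close>
  have Eg: "measure_pmf.expectation ?p (g a) = lam * (k / real n) * of_bool (a \<noteq> None)"
    if a: "a \<in> insert None (Some ` {1..M})" for a
  proof (cases a)
    case None
    then have "g a = (\<lambda>_. 0)" by (simp add: g_def fun_eq_iff)
    then show ?thesis using None by simp
  next
    case (Some l)
    with a have l: "l \<in> {1..M}" "x l \<noteq> 0" using v by (auto simp: valid_params_def)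
    have "measure_pmf.expectation ?p (g a) = (\<Sum>i\<in>{1..M}. if i = l then x i * k / real n * (lam / x l) else 0)"
    proof -
      have *: "g a None = 0" "g a (Some i) = (if i = l then lam / x l else 0)" for i
        by (auto simp: g_def Some)
      show ?thesis
        unfolding expectation_label[OF v] * mult_zero_right add_0_left by (rule sum.cong) auto
    qed
    also have "\<dots> = lam * (k / real n)" using l by (simp add: sum.delta)
    finally show ?thesis using Some by simp
  qed
  have "moment n k lam M x W \<alpha> = measure_pmf.expectation ?L (\<lambda>\<sigma>. measure_pmf.expectation ?p (\<lambda>s. A \<sigma> * B \<sigma> * g (\<sigma> u) s))"
    unfolding moment_def labels_def upd[symmetric]
    by (rule expectation_Pi_pmf_resample) (use w finite_set_label_pmf[OF v] in auto)
  also have "\<dots> = measure_pmf.expectation ?L (\<lambda>\<sigma>. lam * (k / real n) * (A \<sigma> * (of_bool (\<sigma> u \<noteq> None) * B \<sigma>)))"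
  proof (rule integral_cong_AE)
    show "AE \<sigma> in ?L. measure_pmf.expectation ?p (\<lambda>s. A \<sigma> * B \<sigma> * g (\<sigma> u) s)
        = lam * (k / real n) * (A \<sigma> * (of_bool (\<sigma> u \<noteq> None) * B \<sigma>))"
      unfolding AE_measure_pmf_iff
    proof
      fix \<sigma> assume "\<sigma> \<in> set_pmf ?L"
      note Eg[OF set_labels[OF v this, of u]]
      then show "measure_pmf.expectation ?p (\<lambda>s. A \<sigma> * B \<sigma> * g (\<sigma> u) s)
          = lam * (k / real n) * (A \<sigma> * (of_bool (\<sigma> u \<noteq> None) * B \<sigma>))"
        by (simp add: mult_ac del: not_None_eq)
    qed
  qed auto
  also have "\<dots> = lam * (k / real n) * measure_pmf.expectation ?L (\<lambda>\<sigma>. A \<sigma> * (of_bool (\<sigma> u \<noteq> None) * B \<sigma>))"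
    by simp
  also have "(\<lambda>\<sigma>. A \<sigma> * (of_bool (\<sigma> u \<noteq> None) * B \<sigma>))
      = (\<lambda>\<sigma>. (\<Prod>e'\<in>entries n. signal lam x \<sigma> e' ^ (\<alpha>(e := 0)) e') *
          (\<Prod>i\<in>insert u (W - {w}). of_bool (\<sigma> i \<noteq> None)))"
  proof
    fix \<sigma> :: "nat \<Rightarrow> nat option"
    have "(\<Prod>e'\<in>entries n. signal lam x \<sigma> e' ^ (\<alpha>(e := 0)) e') = A \<sigma>"
      unfolding A_def by (subst prod.remove[OF finite_entries e(1)]) (auto intro!: prod.cong)
    moreover have "(\<Prod>i\<in>insert u (W - {w}). of_bool (\<sigma> i \<noteq> None) :: real) = of_bool (\<sigma> u \<noteq> None) * B \<sigma>"
    proof (cases "u \<in> W - {w}")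
      case True
      have "B \<sigma> = 0" if "\<sigma> u = None"
        unfolding B_def using True finW that by (intro prod_zero) auto
      then have "of_bool (\<sigma> u \<noteq> None) * B \<sigma> = B \<sigma>" by (cases "\<sigma> u = None") auto
      then show ?thesis by (simp only: insert_absorb[OF True] B_def)
    qed (use finW in \<open>simp add: B_def\<close>)
    ultimately show "A \<sigma> * (of_bool (\<sigma> u \<noteq> None) * B \<sigma>)
        = (\<Prod>e'\<in>entries n. signal lam x \<sigma> e' ^ (\<alpha>(e := 0)) e') *
          (\<Prod>i\<in>insert u (W - {w}). of_bool (\<sigma> i \<noteq> None))" by simp
  qed
  finally show ?thesis unfolding moment_def .
qed

text \<open>Leaves are stripped one at a time, both models paying the same factor, until no edge
  remains and both sides are \<open>(k / n) ^ card W\<close>. The statement is for all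
  \<open>W\<close> because each removal changes \<open>W\<close>.\<close>

lemma moment_forest:
  assumes P: "valid_params n k lam M x" and Q: "valid_params n k lam M' x'"
    and "forest n \<alpha>" "W \<subseteq> {1..n}"
  shows "moment n k lam M x W \<alpha> = moment n k lam M' x' W \<alpha>"
  using assms(3,4)
proof (induction "sum \<alpha> (entries n)" arbitrary: \<alpha> W rule: less_induct)
  case less
  show ?case
  proof (cases "vset n \<alpha> = {}")
    case True
    then show ?thesis
      using less.prems by (simp add: moment_zero[OF P] moment_zero[OF Q] vset_empty_iff)
  next
    case False
    then have c: "sum \<alpha> (entries n) < card (vset n \<alpha>)" using less.prems by (simp add: forest_def)
    obtain e u v where e: "e \<in> entries n" "\<alpha> e = 1" "u \<noteq> v"
      "e = (u, v) \<or> e = (v, u)"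
      "\<And>e'. e' \<in> entries n \<Longrightarrow> e' \<noteq> e \<Longrightarrow> 0 < \<alpha> e' \<Longrightarrow> fst e' \<noteq> v \<and> snd e' \<noteq> v" by (rule ex_leaf[OF False c], rule that)
    have "sum (\<alpha>(e := 0)) (entries n) < sum \<alpha> (entries n)"
      by (rule sum_strict_mono_ex1[OF finite_entries]) (use e(1,2) in auto)
    moreover have "\<alpha>(e := 0) \<le> \<alpha>" by (simp add: le_fun_def)
    then have "forest n (\<alpha>(e := 0))" using less.prems(1) forest_mono by blast
    moreover have "insert u (W - {v}) \<subseteq> {1..n}" using e less.prems(2) by (auto simp: entries_def)
    ultimately have "moment n k lam M x (insert u (W - {v})) (\<alpha>(e := 0))
        = moment n k lam M' x' (insert u (W - {v})) (\<alpha>(e := 0))" by (rule less.hyps)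
    then show ?thesis
      using moment_leaf[where \<alpha> = \<alpha> and u = u and w = v, OF P less.prems(2) e]
        moment_leaf[where \<alpha> = \<alpha> and u = u and w = v, OF Q less.prems(2) e] by simp
  qed
qed

text \<open>No edge of \<open>\<alpha>\<close> joins \<open>S\<close> to its complement, so the two
  factors are functions of disjoint sets of independent labels.\<close>

lemma moment_restr_mult:
  assumes v: "valid_params n k lam M x" and S: "S \<subseteq> {1..n}"
    and closed: "\<And>e. e \<in> entries n \<Longrightarrow> 0 < \<alpha> e \<Longrightarrow> fst e \<in> S \<longleftrightarrow> snd e \<in> S"
  shows "moment n k lam M x {} \<alpha>
    = moment n k lam M x {} (restr (edges_in n S) \<alpha>) * moment n k lam M x {} (restr (- edges_in n S) \<alpha>)"
proof -
  let ?X = "\<lambda>\<alpha> \<sigma>. \<Prod>e\<in>entries n. signal lam x \<sigma> e ^ \<alpha> e"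
  have "?X \<alpha> \<sigma> = ?X (restr (edges_in n S) \<alpha>) \<sigma> * ?X (restr (- edges_in n S) \<alpha>) \<sigma>" for \<sigma>
    by (simp add: prod.distrib[symmetric] restr_def power_add[symmetric]) (rule prod.cong, auto)
  moreover have "measure_pmf.expectation (labels n k M x)
        (\<lambda>\<sigma>. ?X (restr (edges_in n S) \<alpha>) \<sigma> * ?X (restr (- edges_in n S) \<alpha>) \<sigma>)
      = measure_pmf.expectation (labels n k M x) (?X (restr (edges_in n S) \<alpha>))
        * measure_pmf.expectation (labels n k M x) (?X (restr (- edges_in n S) \<alpha>))"
    unfolding labels_def
  proof (rule expectation_Pi_pmf_indep[OF _ _ _ S])
    fix \<sigma> \<tau> :: "nat \<Rightarrow> nat option"
    assume "\<And>a. a \<in> S \<Longrightarrow> \<sigma> a = \<tau> a"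
    then show "?X (restr (edges_in n S) \<alpha>) \<sigma> = ?X (restr (edges_in n S) \<alpha>) \<tau>"
      by (intro prod.cong) (auto simp: restr_def edges_in_def signal_def split: option.split)
  next
    fix \<sigma> \<tau> :: "nat \<Rightarrow> nat option"
    assume *: "\<And>a. a \<notin> S \<Longrightarrow> \<sigma> a = \<tau> a"
    show "?X (restr (- edges_in n S) \<alpha>) \<sigma> = ?X (restr (- edges_in n S) \<alpha>) \<tau>"
    proof (rule prod.cong[OF refl])
      fix e assume e: "e \<in> entries n"
      show "signal lam x \<sigma> e ^ restr (- edges_in n S) \<alpha> e = signal lam x \<tau> e ^ restr (- edges_in n S) \<alpha> e"
        using closed[OF e] * e by (cases "\<alpha> e = 0") (auto simp: restr_def edges_in_def signal_def split: prod.split option.split)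
    qed
  qed (use S finite_subset finite_set_label_pmf[OF v] in auto)
  ultimately show ?thesis by (simp add: moment_def)
qed

section \<open>The mean gap is bounded by the deconvolution coefficients\<close>

abbreviation mfact :: "'i set \<Rightarrow> ('i \<Rightarrow> nat) \<Rightarrow> real" where
  "mfact E \<beta> \<equiv> (\<Prod>e\<in>E. fact (\<beta> e))"

abbreviation signal_moment ::
  "nat \<Rightarrow> real \<Rightarrow> real \<Rightarrow> nat \<Rightarrow> (nat \<Rightarrow> real) \<Rightarrow> (nat \<times> nat \<Rightarrow> nat) \<Rightarrow> real" where
  "signal_moment n k lam M x \<equiv> moment n k lam M x {}"

lemma hermite_prod_zero: "hermite_prod E (\<lambda>_. 0) y = 1"
  by (simp add: hermite_prod_def)

lemma mbinom_eq_0: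
  assumes "finite E" "\<beta> \<in> midx E D" "\<not> \<beta> \<le> \<delta>"
  shows "mbinom E \<delta> \<beta> = 0"
proof -
  obtain e where e: "\<delta> e < \<beta> e" using assms(3) by (auto simp: le_fun_def not_le)
  then have "e \<in> E" using assms(2) by (auto simp: midx_def)
  then show ?thesis using e assms(1) by (auto simp: mbinom_def prod_zero_iff intro!: bexI[of _ e])
qed

lemma integrable_hermite_prod_mult_unshifted:
  assumes "finite E"
  shows "integrable (PiM E (\<lambda>e. normal_meas (s e))) (\<lambda>y. hermite_prod E \<delta> y * hermite_prod E \<beta> y)"
  using has_bochner_integral_PiM_normal_poly[OF assms, of s "\<lambda>e. hermite (\<delta> e) * hermite (\<beta> e)"]
  by (simp add: hermite_prod_def prod.distrib has_bochner_integral_iff)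

lemma hermite_prod_orthogonal:
  assumes E: "finite E" and "\<beta> \<in> midx E D" "\<delta> \<in> midx E D"
  shows "has_bochner_integral (PiM E (\<lambda>e. normal_meas (s e)))
    (\<lambda>y. hermite_prod E \<delta> (\<lambda>e. y e - s e) * hermite_prod E \<beta> (\<lambda>e. y e - s e))
    (if \<delta> = \<beta> then mfact E \<beta> else 0)"
proof -
  have "(\<Prod>e\<in>E. real (\<delta> e choose \<beta> e) * fact (\<beta> e) * 0 ^ (\<delta> e - \<beta> e)) = (if \<delta> = \<beta> then mfact E \<beta> else 0)"
  proof (cases "\<delta> = \<beta>")
    case False
    then obtain e where e: "\<delta> e \<noteq> \<beta> e" by auto
    then have "e \<in> E" using assms by (auto simp: midx_def) metis
    moreover have "real (\<delta> e choose \<beta> e) * fact (\<beta> e) * 0 ^ (\<delta> e - \<beta> e) = 0" using e by auto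
    ultimately show ?thesis using E False by (simp add: prod_zero_iff) blast
  qed simp
  then show ?thesis using has_bochner_integral_hermite_prod_mult[OF E, where s = s and t = "\<lambda>_. 0" and \<delta> = \<delta> and \<beta> = \<beta>] by simp
qed

text \<open>Cauchy-Schwarz in a form that needs only a nonnegative quadratic in \<open>t\<close>. It
  suits a product of \<open>f\<close> with a function that also depends on the hidden
  labels.\<close>

lemma quadratic_nonneg_discriminant:
  fixes V B S :: real
  assumes nn: "\<And>t. 0 \<le> t\<^sup>2 * V - 2 * t * B + S" and V: "0 \<le> V"
  shows "B\<^sup>2 \<le> S * V"
proof (cases "V = 0")
  case True
  have "B = 0"
  proof (rule ccontr)
    assume B: "B \<noteq> 0"
    \<comment> \<open>With \<open>V = 0\<close> the expression is affine in \<open>t\<close>; this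
      value of \<open>t\<close> makes it equal to -1.\<close>
    have "0 \<le> S - 2 * ((S + 1) / (2 * B)) * B" using nn[of "(S + 1) / (2 * B)"] True by simp
    then show False using B by simp
  qed
  with True show ?thesis by simp
next
  case False
  then have "0 < V" using V by simp
  have "0 \<le> (B / V)\<^sup>2 * V - 2 * (B / V) * B + S" by (rule nn)
  also have "\<dots> = S - B\<^sup>2 / V" using \<open>0 < V\<close> by (simp add: power2_eq_square field_simps)
  finally show ?thesis using \<open>0 < V\<close> by (simp add: field_simps)
qed

text \<open>Given the labels, a Hermite product of the observation has the corresponding monomial of
  the signal as its mean; averaging over the labels produces the signal moments.\<close>

lemma expectation_hermite_prod_sum:
  fixes c :: "_ \<Rightarrow> real"
  assumes v: "valid_params n k lam M x"
  shows "has_bochner_integral (gaussian_model n k lam M x)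
    (\<lambda>y. \<Sum>\<delta>\<in>midx (entries n) D. c \<delta> * hermite_prod (entries n) \<delta> y)
    (\<Sum>\<delta>\<in>midx (entries n) D. c \<delta> * signal_moment n k lam M x \<delta>)"
proof -
  let ?E = "entries n" and ?f = "\<lambda>y. \<Sum>\<delta>\<in>midx (entries n) D. c \<delta> * hermite_prod (entries n) \<delta> y"
  have hb: "has_bochner_integral (noisy_entries n lam x \<sigma>) ?f
      (\<Sum>\<delta>\<in>midx ?E D. c \<delta> * (\<Prod>e\<in>?E. signal lam x \<sigma> e ^ \<delta> e))" for \<sigma>
    unfolding noisy_entries_def
  proof (intro has_bochner_integral_sum has_bochner_integral_mult_right)
    fix \<delta> :: "nat \<times> nat \<Rightarrow> nat"
    show "has_bochner_integral (PiM ?E (\<lambda>e. normal_meas (signal lam x \<sigma> e)))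
       (\<lambda>y. hermite_prod ?E \<delta> y) (\<Prod>e\<in>?E. signal lam x \<sigma> e ^ \<delta> e)"
      using has_bochner_integral_hermite_prod_mult[OF finite_entries[of n], where s = "signal lam x \<sigma>"
          and t = "signal lam x \<sigma>" and \<delta> = \<delta> and \<beta> = "\<lambda>_. 0"]
      by (simp add: hermite_prod_zero)
  qed
  have "has_bochner_integral (gaussian_model n k lam M x) ?f
    (measure_pmf.expectation (labels n k M x) (\<lambda>\<sigma>. \<integral>y. ?f y \<partial>noisy_entries n lam x \<sigma>))"
    by (rule has_bochner_integral_gaussian_model[OF v]) (use hb has_bochner_integral_iff in blast)
  also have "(\<lambda>\<sigma>. \<integral>y. ?f y \<partial>noisy_entries n lam x \<sigma>)
      = (\<lambda>\<sigma>. \<Sum>\<delta>\<in>midx ?E D. c \<delta> * (\<Prod>e\<in>?E. signal lam x \<sigma> e ^ \<delta> e))"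
    using hb has_bochner_integral_iff by blast
  also have "measure_pmf.expectation (labels n k M x) \<dots> = (\<Sum>\<delta>\<in>midx ?E D. c \<delta> * signal_moment n k lam M x \<delta>)"
    by (simp add: moment_def Bochner_Integration.integral_sum integrable_labels[OF v])
  finally show ?thesis .
qed

text \<open>Pairing \<open>f\<close> with \<open>G\<close> under \<open>Q\<close> reproduces the
  mean gap, since \<open>r\<close> convolved with the moments of \<open>Q\<close> gives those of
  \<open>P\<close>. The second moment of \<open>G\<close> comes from orthogonality of the noise
  alone.\<close>

lemma mean_gap_sq_le_hermite_prod:
  fixes c :: "_ \<Rightarrow> real"
  assumes P: "valid_params n k lam M x" and Q: "valid_params n k lam M' x'"
    and f: "\<And>y. f y = (\<Sum>\<delta>\<in>midx (entries n) D. c \<delta> * hermite_prod (entries n) \<delta> y)"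
  defines "r \<equiv> deconv (entries n) (signal_moment n k lam M x) (signal_moment n k lam M' x')"
  shows "(integral\<^sup>L (gaussian_model n k lam M x) f - integral\<^sup>L (gaussian_model n k lam M' x') f)\<^sup>2
    \<le> (\<Sum>\<beta>\<in>midx (entries n) D - {\<lambda>_. 0}. (r \<beta>)\<^sup>2 / mfact (entries n) \<beta>)
      * (\<integral>y. (f y)\<^sup>2 \<partial>gaussian_model n k lam M' x')"
proof -
  let ?E = "entries n" and ?I = "midx (entries n) D"
  let ?J = "?I - {\<lambda>_. 0}"
  let ?N = "noisy_entries n lam x'" and ?L = "labels n k M' x'"
  let ?s = "\<lambda>\<sigma>. signal lam x' \<sigma>"
  let ?mP = "signal_moment n k lam M x" and ?mQ = "signal_moment n k lam M' x'"
  note E = finite_entries[of n]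
  have I: "finite ?I" by (rule finite_midx[OF E])
  have zero: "(\<lambda>_. 0) \<in> ?I" by (simp add: midx_def)
  have m0: "?mP (\<lambda>_. 0) = 1" "?mQ (\<lambda>_. 0) = 1" by (simp_all add: moment_def)
  have r0: "r (\<lambda>_. 0) = 1" unfolding r_def by (subst deconv.simps) (simp add: m0)
  \<comment> \<open>a polynomial in the noise \<open>y - signal\<close> alone\<close>
  define G where "G \<sigma> y = (\<Sum>\<beta>\<in>?J. r \<beta> / mfact ?E \<beta> * hermite_prod ?E \<beta> (\<lambda>e. y e - ?s \<sigma> e))" for \<sigma> y
  define S where "S = (\<Sum>\<beta>\<in>?J. (r \<beta>)\<^sup>2 / mfact ?E \<beta>)"
  have fct: "mfact ?E \<beta> \<noteq> 0" for \<beta> by (simp add: E)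
  define b where "b \<sigma> = (\<Sum>\<delta>\<in>?I. \<Sum>\<beta>\<in>?J. c \<delta> * (r \<beta> * mbinom ?E \<delta> \<beta> * (\<Prod>e\<in>?E. ?s \<sigma> e ^ (\<delta> e - \<beta> e))))" for \<sigma>
  have fG: "has_bochner_integral (?N \<sigma>) (\<lambda>y. f y * G \<sigma> y) (b \<sigma>)" for \<sigma>
  proof -
    have "has_bochner_integral (?N \<sigma>)
      (\<lambda>y. \<Sum>\<delta>\<in>?I. \<Sum>\<beta>\<in>?J. c \<delta> * (r \<beta> / mfact ?E \<beta>) *
          (hermite_prod ?E \<delta> (\<lambda>e. y e - ?s \<sigma> e + ?s \<sigma> e) * hermite_prod ?E \<beta> (\<lambda>e. y e - ?s \<sigma> e)))
      (\<Sum>\<delta>\<in>?I. \<Sum>\<beta>\<in>?J. c \<delta> * (r \<beta> / mfact ?E \<beta>) *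
          (\<Prod>e\<in>?E. real (\<delta> e choose \<beta> e) * fact (\<beta> e) * ?s \<sigma> e ^ (\<delta> e - \<beta> e)))"
      unfolding noisy_entries_def
      by (intro has_bochner_integral_sum has_bochner_integral_mult_right has_bochner_integral_hermite_prod_mult E)
    also have "(\<lambda>y. \<Sum>\<delta>\<in>?I. \<Sum>\<beta>\<in>?J. c \<delta> * (r \<beta> / mfact ?E \<beta>) *
          (hermite_prod ?E \<delta> (\<lambda>e. y e - ?s \<sigma> e + ?s \<sigma> e) * hermite_prod ?E \<beta> (\<lambda>e. y e - ?s \<sigma> e))) = (\<lambda>y. f y * G \<sigma> y)"
      by (simp add: fun_eq_iff f G_def sum_product mult_ac)
    also have "(\<Sum>\<delta>\<in>?I. \<Sum>\<beta>\<in>?J. c \<delta> * (r \<beta> / mfact ?E \<beta>) *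
          (\<Prod>e\<in>?E. real (\<delta> e choose \<beta> e) * fact (\<beta> e) * ?s \<sigma> e ^ (\<delta> e - \<beta> e))) = b \<sigma>"
      unfolding b_def mbinom_def prod.distrib using fct by (intro sum.cong) simp_all
    finally show ?thesis .
  qed
  \<comment> \<open>\<open>G\<close> is centred at the signal, so its conditional second moment is
    the same number \<open>S\<close> for every label vector, and averaging over labels costs
    nothing.\<close>
  have GG: "has_bochner_integral (?N \<sigma>) (\<lambda>y. G \<sigma> y * G \<sigma> y) S" for \<sigma>
  proof -
    have "has_bochner_integral (?N \<sigma>)
      (\<lambda>y. \<Sum>\<delta>\<in>?J. \<Sum>\<beta>\<in>?J. (r \<delta> / mfact ?E \<delta>) * (r \<beta> / mfact ?E \<beta>) *
          (hermite_prod ?E \<delta> (\<lambda>e. y e - ?s \<sigma> e) * hermite_prod ?E \<beta> (\<lambda>e. y e - ?s \<sigma> e)))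
      (\<Sum>\<delta>\<in>?J. \<Sum>\<beta>\<in>?J. (r \<delta> / mfact ?E \<delta>) * (r \<beta> / mfact ?E \<beta>) *
          (if \<delta> = \<beta> then mfact ?E \<beta> else 0))"
      unfolding noisy_entries_def
      by (intro has_bochner_integral_sum has_bochner_integral_mult_right hermite_prod_orthogonal[where D = D] E) auto
    also have "(\<lambda>y. \<Sum>\<delta>\<in>?J. \<Sum>\<beta>\<in>?J. (r \<delta> / mfact ?E \<delta>) * (r \<beta> / mfact ?E \<beta>) *
          (hermite_prod ?E \<delta> (\<lambda>e. y e - ?s \<sigma> e) * hermite_prod ?E \<beta> (\<lambda>e. y e - ?s \<sigma> e))) = (\<lambda>y. G \<sigma> y * G \<sigma> y)"
      by (simp add: fun_eq_iff G_def sum_product mult_ac)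
    also have "(\<Sum>\<delta>\<in>?J. \<Sum>\<beta>\<in>?J. (r \<delta> / mfact ?E \<delta>) * (r \<beta> / mfact ?E \<beta>) *
          (if \<delta> = \<beta> then mfact ?E \<beta> else 0)) = S"
      unfolding S_def
    proof (rule sum.cong[OF refl])
      fix \<delta> assume d: "\<delta> \<in> ?J"
      have "(\<Sum>\<beta>\<in>?J. (r \<delta> / mfact ?E \<delta>) * (r \<beta> / mfact ?E \<beta>) * (if \<delta> = \<beta> then mfact ?E \<beta> else 0))
        = (\<Sum>\<beta>\<in>?J. if \<delta> = \<beta> then (r \<delta>)\<^sup>2 / mfact ?E \<delta> else 0)"
        by (intro sum.cong) (use fct in \<open>auto simp: power2_eq_square\<close>)
      also have "\<dots> = (r \<delta>)\<^sup>2 / mfact ?E \<delta>" using d I by (subst sum.delta') auto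
      finally show "(\<Sum>\<beta>\<in>?J. (r \<delta> / mfact ?E \<delta>) * (r \<beta> / mfact ?E \<beta>) * (if \<delta> = \<beta> then mfact ?E \<beta> else 0))
        = (r \<delta>)\<^sup>2 / mfact ?E \<delta>" .
    qed
    finally show ?thesis .
  qed
  have ff: "integrable (?N \<sigma>) (\<lambda>y. f y * f y)" for \<sigma>
  proof -
    have "integrable (?N \<sigma>) (\<lambda>y. \<Sum>\<delta>\<in>?I. \<Sum>\<beta>\<in>?I. c \<delta> * c \<beta> * (hermite_prod ?E \<delta> y * hermite_prod ?E \<beta> y))"
      unfolding noisy_entries_def
      by (intro Bochner_Integration.integrable_sum integrable_mult_right integrable_hermite_prod_mult_unshifted E)
    also have "(\<lambda>y. \<Sum>\<delta>\<in>?I. \<Sum>\<beta>\<in>?I. c \<delta> * c \<beta> * (hermite_prod ?E \<delta> y * hermite_prod ?E \<beta> y)) = (\<lambda>y. f y * f y)"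
      by (simp add: fun_eq_iff f sum_product mult_ac)
    finally show ?thesis .
  qed
  define V where "V = (\<integral>y. (f y)\<^sup>2 \<partial>gaussian_model n k lam M' x')"
  have V: "V = measure_pmf.expectation ?L (\<lambda>\<sigma>. \<integral>y. f y * f y \<partial>?N \<sigma>)"
    unfolding V_def power2_eq_square
    using has_bochner_integral_gaussian_model[OF Q ff] has_bochner_integral_iff by blast
  define B where "B = measure_pmf.expectation ?L b"
  \<comment> \<open>\<open>G\<close> depends on the labels and is not a function of the observation
    alone. The square \<open>(t * f - G)^2\<close> is therefore integrated for fixed labels first,
    and the result is averaged.\<close>
  have "0 \<le> t\<^sup>2 * V - 2 * t * B + S" for t
  proof -
    have "0 \<le> t\<^sup>2 * (\<integral>y. f y * f y \<partial>?N \<sigma>) - 2 * t * b \<sigma> + S" for \<sigma>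
    proof -
      have "has_bochner_integral (?N \<sigma>) (\<lambda>y. t\<^sup>2 * (f y * f y) - 2 * t * (f y * G \<sigma> y) + G \<sigma> y * G \<sigma> y)
          (t\<^sup>2 * (\<integral>y. f y * f y \<partial>?N \<sigma>) - 2 * t * b \<sigma> + S)"
        by (intro has_bochner_integral_add has_bochner_integral_diff has_bochner_integral_mult_right fG GG
            has_bochner_integral_integrable ff)
      moreover have "(\<lambda>y. t\<^sup>2 * (f y * f y) - 2 * t * (f y * G \<sigma> y) + G \<sigma> y * G \<sigma> y) = (\<lambda>y. (t * f y - G \<sigma> y)\<^sup>2)"
        by (simp add: fun_eq_iff power2_eq_square algebra_simps)
      ultimately have "t\<^sup>2 * (\<integral>y. f y * f y \<partial>?N \<sigma>) - 2 * t * b \<sigma> + S = (\<integral>y. (t * f y - G \<sigma> y)\<^sup>2 \<partial>?N \<sigma>)"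
        by (simp add: has_bochner_integral_iff)
      then show ?thesis by simp
    qed
    then have "0 \<le> measure_pmf.expectation ?L (\<lambda>\<sigma>. t\<^sup>2 * (\<integral>y. f y * f y \<partial>?N \<sigma>) - 2 * t * b \<sigma> + S)"
      by (intro integral_nonneg_AE) auto
    also have "\<dots> = t\<^sup>2 * V - 2 * t * B + S"
      unfolding V B_def by (simp add: integrable_labels[OF Q])
    finally show ?thesis .
  qed
  moreover have "0 \<le> V" unfolding V_def by simp
  ultimately have "B\<^sup>2 \<le> S * V" by (rule quadratic_nonneg_discriminant)
  \<comment> \<open>The index 0 was left out of \<open>G\<close>. In the convolution identity for
    \<open>?mP\<close> its term is \<open>?mQ \<delta>\<close>, so the rest is exactly the
    difference of moments.\<close>
  moreover have "B = integral\<^sup>L (gaussian_model n k lam M x) f - integral\<^sup>L (gaussian_model n k lam M' x') f"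
  proof -
    have "B = (\<Sum>\<delta>\<in>?I. \<Sum>\<beta>\<in>?J. c \<delta> * (r \<beta> * mbinom ?E \<delta> \<beta> * ?mQ (\<lambda>e. \<delta> e - \<beta> e)))"
      unfolding B_def b_def moment_def
      by (simp add: Bochner_Integration.integral_sum integrable_labels[OF Q])
    also have "\<dots> = (\<Sum>\<delta>\<in>?I. c \<delta> * (?mP \<delta> - ?mQ \<delta>))"
    proof (rule sum.cong[OF refl])
      fix \<delta> assume d: "\<delta> \<in> ?I"
      let ?t = "\<lambda>\<beta>. mbinom ?E \<delta> \<beta> * r \<beta> * ?mQ (\<lambda>e. \<delta> e - \<beta> e)"
      have "?mP \<delta> = (\<Sum>\<beta>\<le>\<delta>. ?t \<beta>)"
        unfolding r_def by (rule deconv_conv[where m' = ?mQ, OF E d m0(2)])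
      also have "\<dots> = (\<Sum>\<beta>\<in>?I. ?t \<beta>)"
        by (rule sum.mono_neutral_left[OF I])
           (use midx_mono[OF _ d] mbinom_eq_0[OF E] in auto)
      also have "\<dots> = ?mQ \<delta> + (\<Sum>\<beta>\<in>?J. ?t \<beta>)"
        by (subst sum.remove[OF I zero]) (simp add: r0 mbinom_def)
      finally show "(\<Sum>\<beta>\<in>?J. c \<delta> * (r \<beta> * mbinom ?E \<delta> \<beta> * ?mQ (\<lambda>e. \<delta> e - \<beta> e))) = c \<delta> * (?mP \<delta> - ?mQ \<delta>)"
        by (simp add: sum_distrib_left mult_ac)
    qed
    also have "\<dots> = integral\<^sup>L (gaussian_model n k lam M x) f - integral\<^sup>L (gaussian_model n k lam M' x') f"
      using expectation_hermite_prod_sum[OF P, where D = D and c = c] expectation_hermite_prod_sum[OF Q, where D = D and c = c]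
      by (simp add: has_bochner_integral_iff f[abs_def] sum_subtractf right_diff_distrib)
    finally show ?thesis .
  qed
  ultimately show ?thesis unfolding S_def V_def by simp
qed

text \<open>Subtracting the mean under \<open>Q\<close> changes only the constant Hermite
  coefficient and leaves the gap untouched, which turns the second moment into a variance.\<close>

lemma mean_gap_sq_le:
  assumes P: "valid_params n k lam M x" and Q: "valid_params n k lam M' x'"
    and f: "poly_fun_on (entries n) D f"
  defines "r \<equiv> deconv (entries n) (signal_moment n k lam M x) (signal_moment n k lam M' x')"
  shows "(mean_gap (gaussian_model n k lam M x) (gaussian_model n k lam M' x') f)\<^sup>2
    \<le> (\<Sum>\<beta>\<in>midx (entries n) D - {\<lambda>_. 0}. (r \<beta>)\<^sup>2 / mfact (entries n) \<beta>)
      * (\<integral>y. (f y - integral\<^sup>L (gaussian_model n k lam M' x') f)\<^sup>2 \<partial>gaussian_model n k lam M' x')"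
proof -
  let ?E = "entries n" and ?I = "midx (entries n) D"
  let ?P = "gaussian_model n k lam M x" and ?Q = "gaussian_model n k lam M' x'"
  obtain c where c: "\<And>y. f y = (\<Sum>\<delta>\<in>?I. c \<delta> * hermite_prod ?E \<delta> y)"
    using poly_fun_on_hermite_prod_span[OF finite_entries f] by blast
  define \<mu> where "\<mu> = integral\<^sup>L ?Q f"
  define c' where "c' = c((\<lambda>_. 0) := c (\<lambda>_. 0) - \<mu>)"
  have I: "finite ?I" "(\<lambda>_. 0) \<in> ?I" by (rule finite_midx[OF finite_entries]) (simp add: midx_def)
  have F: "f y - \<mu> = (\<Sum>\<delta>\<in>?I. c' \<delta> * hermite_prod ?E \<delta> y)" for y
    unfolding c c'_def by (subst (1 2) sum.remove[OF I]) (simp add: hermite_prod_zero)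
  interpret P: prob_space ?P by (rule prob_space_gaussian_model)
  interpret Q: prob_space ?Q by (rule prob_space_gaussian_model)
  have int: "integrable ?P f" "integrable ?Q f"
    using expectation_hermite_prod_sum[OF P, where D = D and c = c] expectation_hermite_prod_sum[OF Q, where D = D and c = c]
    by (simp_all add: has_bochner_integral_iff c[abs_def])
  have "(integral\<^sup>L ?P (\<lambda>y. f y - \<mu>) - integral\<^sup>L ?Q (\<lambda>y. f y - \<mu>))\<^sup>2 =
     (mean_gap ?P ?Q f)\<^sup>2"
    using int by (simp add: mean_gap_def P.prob_space Q.prob_space)
  then show ?thesis
    using mean_gap_sq_le_hermite_prod[OF P Q F] unfolding r_def \<mu>_def by simp
qed

section \<open>Summing the deconvolution coefficients\<close>

text \<open>Too few edges force a forest part that no edge leaves. Closedness and acyclicity pass to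
  every submultigraph, so both moment sequences factor along it with equal forest factors, which
  cancel.\<close>

lemma deconv_moment_eq_0:
  assumes P: "valid_params n k lam M x" and Q: "valid_params n k lam M' x'"
    and \<alpha>: "\<alpha> \<in> midx (entries n) D" and less: "sum \<alpha> (entries n) < card (vset n \<alpha>)"
  shows "deconv (entries n) (signal_moment n k lam M x) (signal_moment n k lam M' x') \<alpha> = 0"
proof -
  obtain S where S: "S \<subseteq> {1..n}" "restr (edges_in n S) \<alpha> \<noteq> (\<lambda>_. 0)" "forest n (restr (edges_in n S) \<alpha>)"
    "\<And>e. e \<in> entries n \<Longrightarrow> 0 < \<alpha> e \<Longrightarrow> fst e \<in> S \<longleftrightarrow> snd e \<in> S"
    by (rule ex_forest_part[OF less], rule that)
  have closed: "fst e \<in> S \<longleftrightarrow> snd e \<in> S" if "\<beta> \<le> \<alpha>" "e \<in> entries n" "0 < \<beta> e" for \<beta> e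
    using S(4)[OF that(2)] le_funD[OF that(1), of e] that(3) by simp
  show ?thesis
  proof (rule deconv_eq_0[where F = "edges_in n S", OF finite_entries \<alpha>])
    show "signal_moment n k lam M' x' (\<lambda>_. 0) = 1" by (simp add: moment_def)
    fix \<beta> assume \<beta>: "\<beta> \<le> \<alpha>"
    show "signal_moment n k lam M x \<beta> = signal_moment n k lam M x (restr (edges_in n S) \<beta>)
        * signal_moment n k lam M x (restr (- edges_in n S) \<beta>)"
      by (rule moment_restr_mult[OF P S(1) closed[OF \<beta>]])
    show "signal_moment n k lam M' x' \<beta> = signal_moment n k lam M' x' (restr (edges_in n S) \<beta>)
        * signal_moment n k lam M' x' (restr (- edges_in n S) \<beta>)"
      by (rule moment_restr_mult[OF Q S(1) closed[OF \<beta>]])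
    have "restr (edges_in n S) \<beta> \<le> restr (edges_in n S) \<alpha>" using \<beta> by (simp add: restr_def le_fun_def)
    then show "signal_moment n k lam M x (restr (edges_in n S) \<beta>) = signal_moment n k lam M' x' (restr (edges_in n S) \<beta>)"
      by (intro moment_forest[OF P Q]) (use forest_mono[OF S(3)] in auto)
  qed (rule S(2))
qed

lemma card_vset_le_add:
  assumes "\<beta> \<le> \<alpha>"
  shows "card (vset n \<alpha>) \<le> card (vset n \<beta>) + card (vset n (\<lambda>e. \<alpha> e - \<beta> e))"
proof -
  have "vset n \<alpha> \<subseteq> vset n \<beta> \<union> vset n (\<lambda>e. \<alpha> e - \<beta> e)"
  proof
    fix v assume "v \<in> vset n \<alpha>"
    then obtain e where e: "e \<in> entries n" "0 < \<alpha> e" "v = fst e \<or> v = snd e" by (auto simp: vset_def)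
    then have "0 < \<beta> e \<or> 0 < \<alpha> e - \<beta> e" by auto
    with e show "v \<in> vset n \<beta> \<union> vset n (\<lambda>e. \<alpha> e - \<beta> e)" by (auto simp: vset_def)
  qed
  then show ?thesis by (meson card_Un_le card_mono finite_UnI finite_vset order_trans)
qed

text \<open>Group by vertex set: \<open>d\<close> edges among at most \<open>d^2\<close> pairs give
  at most \<open>d ^ (2 * d)\<close> multigraphs. The weight \<open>(1 / n) ^ j\<close> pays for the
  at most \<open>n ^ j\<close> sets of size \<open>j\<close>, and \<open>j\<close> takes
  \<open>d + 1\<close> values.\<close>

lemma sum_inverse_power_card_vset:
  assumes n: "1 \<le> n"
  shows "(\<Sum>\<beta>\<in>{\<beta>\<in>midx (entries n) D. sum \<beta> (entries n) = d \<and> card (vset n \<beta>) \<le> d}.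
      (1 / real n) ^ card (vset n \<beta>)) \<le> real (d + 1) * real d ^ (2 * d)"
proof -
  let ?A = "{\<beta>\<in>midx (entries n) D. sum \<beta> (entries n) = d \<and> card (vset n \<beta>) \<le> d}"
  let ?VV = "{V\<in>Pow {1..n}. card V \<le> d}"
  have finA: "finite ?A" using finite_midx[OF finite_entries] by simp
  have "(\<Sum>\<beta>\<in>?A. (1 / real n) ^ card (vset n \<beta>))
      = (\<Sum>V\<in>?VV. \<Sum>\<beta>\<in>{\<beta>\<in>?A. vset n \<beta> = V}. (1 / real n) ^ card (vset n \<beta>))"
    by (rule sum.group[OF finA, symmetric]) (use vset_subset in auto)
  also have "\<dots> \<le> (\<Sum>V\<in>?VV. real d ^ (2 * d) * (1 / real n) ^ card V)"
  proof (rule sum_mono)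
    fix V assume V: "V \<in> ?VV"
    then have finV: "finite V" using finite_subset by auto
    let ?B = "{\<beta>. (\<forall>e. e \<notin> edges_in n V \<longrightarrow> \<beta> e = 0) \<and> sum \<beta> (edges_in n V) = d}"
    have sub: "{\<beta>\<in>?A. vset n \<beta> = V} \<subseteq> ?B"
    proof
      fix \<beta> assume b: "\<beta> \<in> {\<beta>\<in>?A. vset n \<beta> = V}"
      then have z: "\<beta> e = 0" if "e \<notin> edges_in n V" for e
      proof (cases "e \<in> entries n")
        case True
        then show ?thesis using b that by (auto simp: edges_in_def vset_def)
      next
        case False
        then show ?thesis using b by (cases e) (simp add: midx_def)
      qed
      then have "sum \<beta> (edges_in n V) = sum \<beta> (entries n)"
        by (intro sum.mono_neutral_left) (auto simp: finite_entries edges_in_def)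
      with b z show "\<beta> \<in> ?B" by simp
    qed
    have "edges_in n V \<subseteq> V \<times> V" by (auto simp: edges_in_def)
    then have "card (edges_in n V) \<le> card V * card V"
      using card_mono[of "V \<times> V"] finV by (simp add: card_cartesian_product)
    also have "\<dots> \<le> d * d" using V by (intro mult_mono) auto
    finally have "card (edges_in n V) \<le> d\<^sup>2" by (simp add: power2_eq_square)
    then have "card (edges_in n V) ^ d \<le> (d\<^sup>2) ^ d" by (rule power_mono) simp
    moreover have "card {\<beta>\<in>?A. vset n \<beta> = V} \<le> card (edges_in n V) ^ d"
      using card_exact_degree[OF finite_edges_in, of n V d] card_mono[OF _ sub] by linarith
    ultimately have "card {\<beta>\<in>?A. vset n \<beta> = V} \<le> d ^ (2 * d)" by (simp add: power_mult)
    then have "real (card {\<beta>\<in>?A. vset n \<beta> = V}) \<le> real d ^ (2 * d)"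
      unfolding of_nat_power[symmetric] of_nat_le_iff .
    then show "(\<Sum>\<beta>\<in>{\<beta>\<in>?A. vset n \<beta> = V}. (1 / real n) ^ card (vset n \<beta>))
        \<le> real d ^ (2 * d) * (1 / real n) ^ card V"
      by (simp add: mult_right_mono divide_right_mono)
  qed
  also have "\<dots> = real d ^ (2 * d) * (\<Sum>V\<in>?VV. (1 / real n) ^ card V)"
    by (rule sum_distrib_left[symmetric])
  finally have 1: "(\<Sum>\<beta>\<in>?A. (1 / real n) ^ card (vset n \<beta>))
      \<le> real d ^ (2 * d) * (\<Sum>V\<in>?VV. (1 / real n) ^ card V)" .
  have "(\<Sum>V\<in>?VV. (1 / real n) ^ card V)
      = (\<Sum>j\<in>{..d}. \<Sum>V\<in>{V\<in>?VV. card V = j}. (1 / real n) ^ card V)"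
    by (rule sum.group[symmetric]) auto
  also have "\<dots> \<le> (\<Sum>j\<in>{..d}. 1)"
  proof (rule sum_mono)
    fix j assume "j \<in> {..d}"
    then have eq: "{V\<in>?VV. card V = j} = {V. V \<subseteq> {1..n} \<and> card V = j}" by auto
    have "(\<Sum>V\<in>{V\<in>?VV. card V = j}. (1 / real n) ^ card V) = real (n choose j) * (1 / real n) ^ j"
      unfolding eq using n_subsets[of "{1..n}" j] by simp
    also have "real (n choose j) \<le> real n ^ j"
    proof (cases "j \<le> n")
      case True
      then show ?thesis using binomial_le_pow[OF True] by (metis of_nat_le_iff of_nat_power)
    qed (simp add: binomial_eq_0)
    then have "real (n choose j) * (1 / real n) ^ j \<le> real n ^ j * (1 / real n) ^ j"
      by (intro mult_right_mono) auto
    also have "real n ^ j * (1 / real n) ^ j = 1" using n by (simp add: power_mult_distrib[symmetric])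
    finally show "(\<Sum>V\<in>{V\<in>?VV. card V = j}. (1 / real n) ^ card V) \<le> 1" .
  qed
  also have "\<dots> = real (d + 1)" by simp
  finally have "real d ^ (2 * d) * (\<Sum>V\<in>?VV. (1 / real n) ^ card V) \<le> real d ^ (2 * d) * real (d + 1)"
    by (rule mult_left_mono) simp
  with 1 show ?thesis by (simp only: mult.commute[of "real (d + 1)"])
qed

lemma midx_sum_bounds:
  assumes "finite E" "\<beta> \<in> midx E D" "\<beta> \<noteq> (\<lambda>_. 0)"
  shows "1 \<le> sum \<beta> E \<and> sum \<beta> E \<le> D"
proof -
  obtain e where "\<beta> e \<noteq> 0" using assms(3) by auto
  then have "sum \<beta> E \<noteq> 0" using assms(1,2) by (auto simp: midx_def)
  then show ?thesis using assms(2) by (simp add: midx_def)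
qed

text \<open>Origin of \<open>32 * D ^ 4\<close>: squaring the factor \<open>4 * D\<close> of
  \<open>deconv_bound\<close> gives \<open>16 * D^2\<close>, the choice of edges another
  \<open>D^2\<close>, and the \<open>d + 1\<close> possible vertex counts are absorbed into
  \<open>2 ^ d\<close>.\<close>

lemma sum_deconv_sq_le:
  assumes P: "valid_params n k lam M x" and Q: "valid_params n k lam M' x'"
    and K: "\<And>l. l \<in> {1..M} \<Longrightarrow> lam / x l \<le> K" "\<And>l. l \<in> {1..M'} \<Longrightarrow> lam / x' l \<le> K"
  defines "r \<equiv> deconv (entries n) (signal_moment n k lam M x) (signal_moment n k lam M' x')"
  shows "(\<Sum>\<beta>\<in>midx (entries n) D - {\<lambda>_. 0}. (r \<beta>)\<^sup>2 / mfact (entries n) \<beta>)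
    \<le> (\<Sum>d\<in>{1..D}. (32 * real D ^ 4 * K\<^sup>2 * max (k\<^sup>2 / real n) 1) ^ d)"
proof -
  let ?E = "entries n" and ?I = "midx (entries n) D"
  let ?v = "\<lambda>\<beta>. card (vset n \<beta>)" and ?T = "max (k\<^sup>2 / real n) 1"
  note E = finite_entries[of n]
  have n: "1 \<le> n" and k: "0 < k" "k \<le> real n" and lam: "0 < lam" using P by (auto simp: valid_params_def)
  have "0 < lam / x 1" using P by (auto simp: valid_params_def)
  moreover have "lam / x 1 \<le> K" using K(1)[of 1] P by (auto simp: valid_params_def)
  ultimately have K0: "0 \<le> K" by linarith
  have q: "0 \<le> k / real n" "k / real n \<le> 1" using k n by auto
  have r: "\<bar>r \<beta>\<bar> \<le> (4 * real D) ^ sum \<beta> ?E * K ^ sum \<beta> ?E * (k / real n) ^ ?v \<beta>" if "\<beta> \<in> ?I" for \<beta>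
    unfolding r_def
    by (rule deconv_bound[OF E q K0 moment_bound[OF P K(1)] moment_bound[OF Q K(2)] card_vset_le_add that])
  have tm: "(r \<beta>)\<^sup>2 / mfact ?E \<beta>
      \<le> (if ?v \<beta> \<le> sum \<beta> ?E then (16 * real D ^ 2 * K\<^sup>2 * ?T) ^ sum \<beta> ?E * (1 / real n) ^ ?v \<beta> else 0)"
    if b: "\<beta> \<in> ?I" for \<beta>
  proof (cases "?v \<beta> \<le> sum \<beta> ?E")
    case False
    then show ?thesis using deconv_moment_eq_0[OF P Q b] by (simp add: r_def)
  next
    case True
    let ?d = "sum \<beta> ?E"
    have "(1::real) \<le> mfact ?E \<beta>" by (intro prod_ge_1) (simp add: fact_ge_1)
    then have "(r \<beta>)\<^sup>2 / mfact ?E \<beta> \<le> (r \<beta>)\<^sup>2 / 1"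
      by (intro divide_left_mono) auto
    also have "(r \<beta>)\<^sup>2 / 1 \<le> ((4 * real D) ^ ?d * K ^ ?d * (k / real n) ^ ?v \<beta>)\<^sup>2"
      using power_mono[OF r[OF b] abs_ge_zero, of 2] by simp
    also have "\<dots> = (16 * real D ^ 2 * K\<^sup>2) ^ ?d * ((k / real n)\<^sup>2) ^ ?v \<beta>"
    proof -
      have "(16::real) ^ ?d = 4 ^ ?d * 4 ^ ?d" by (simp flip: power_mult_distrib)
      moreover have "(a * b * c)\<^sup>2 = a * a * (b * b) * (c * c)" for a b c :: real
        by (simp add: power2_eq_square)
      ultimately show ?thesis by (simp only: power_mult_distrib power2_eq_square) (simp only: mult_ac)
    qed
    \<comment> \<open>One factor \<open>1 / n\<close> per vertex is set aside for the choice of the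
      vertex set. The other, \<open>k^2 / n\<close>, is replaced by its maximum with 1 so that its
      exponent can be raised from \<open>v\<close> to \<open>d\<close>.\<close>
    also have "(k / real n)\<^sup>2 = (k\<^sup>2 / real n) * (1 / real n)" by (simp add: power2_eq_square)
    also have "(16 * real D ^ 2 * K\<^sup>2) ^ ?d * ((k\<^sup>2 / real n) * (1 / real n)) ^ ?v \<beta>
        \<le> (16 * real D ^ 2 * K\<^sup>2) ^ ?d * (?T ^ ?d * (1 / real n) ^ ?v \<beta>)"
    proof (rule mult_left_mono)
      have "(k\<^sup>2 / real n) ^ ?v \<beta> \<le> ?T ^ ?v \<beta>" by (intro power_mono) auto
      also have "\<dots> \<le> ?T ^ ?d" using True by (intro power_increasing) auto
      finally show "((k\<^sup>2 / real n) * (1 / real n)) ^ ?v \<beta> \<le> ?T ^ ?d * (1 / real n) ^ ?v \<beta>"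
        unfolding power_mult_distrib by (intro mult_right_mono) auto
    qed simp
    finally show ?thesis using True by (simp add: power_mult_distrib mult_ac)
  qed
  have I: "finite (?I - {\<lambda>_. 0})" using finite_midx[OF E] by simp
  have "(\<Sum>\<beta>\<in>?I - {\<lambda>_. 0}. (r \<beta>)\<^sup>2 / mfact ?E \<beta>)
     = (\<Sum>d\<in>{1..D}. \<Sum>\<beta>\<in>{\<beta>\<in>?I - {\<lambda>_. 0}. sum \<beta> ?E = d}. (r \<beta>)\<^sup>2 / mfact ?E \<beta>)"
  proof (rule sum.group[OF I, symmetric])
    show "(\<lambda>\<beta>. sum \<beta> ?E) ` (?I - {\<lambda>_. 0}) \<subseteq> {1..D}"
    proof (rule image_subsetI)
      fix \<beta> assume "\<beta> \<in> ?I - {\<lambda>_. 0}"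
      with midx_sum_bounds[OF E, of \<beta> D] show "sum \<beta> ?E \<in> {1..D}" by simp
    qed
  qed simp
  also have "\<dots> \<le> (\<Sum>d\<in>{1..D}. (32 * real D ^ 4 * K\<^sup>2 * ?T) ^ d)"
  proof (rule sum_mono)
    fix d assume d: "d \<in> {1..D}"
    let ?c = "16 * real D ^ 2 * K\<^sup>2 * ?T"
    let ?A = "{\<beta>\<in>?I. sum \<beta> ?E = d \<and> ?v \<beta> \<le> d}"
    have c0: "0 \<le> ?c" by simp
    have "(\<Sum>\<beta>\<in>{\<beta>\<in>?I - {\<lambda>_. 0}. sum \<beta> ?E = d}. (r \<beta>)\<^sup>2 / mfact ?E \<beta>)
        \<le> (\<Sum>\<beta>\<in>{\<beta>\<in>?I - {\<lambda>_. 0}. sum \<beta> ?E = d}. if ?v \<beta> \<le> sum \<beta> ?E then ?c ^ sum \<beta> ?E * (1 / real n) ^ ?v \<beta> else 0)"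
      by (intro sum_mono tm) auto
    also have "\<dots> = (\<Sum>\<beta>\<in>?A. ?c ^ d * (1 / real n) ^ ?v \<beta>)"
      by (rule sum.mono_neutral_cong_right) (use I d in \<open>auto simp: finite_midx[OF E]\<close>)
    also have "\<dots> = ?c ^ d * (\<Sum>\<beta>\<in>?A. (1 / real n) ^ ?v \<beta>)"
      by (rule sum_distrib_left[symmetric])
    also have "\<dots> \<le> ?c ^ d * (real (d + 1) * real d ^ (2 * d))"
      by (intro mult_left_mono sum_inverse_power_card_vset[OF n] zero_le_power c0)
    also have "\<dots> \<le> ?c ^ d * (2 ^ d * real D ^ (2 * d))"
    proof (intro mult_left_mono mult_mono power_mono zero_le_power c0)
      have "d < 2 ^ d" by (rule less_exp)
      then have "d + 1 \<le> 2 ^ d" by linarith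
      then have "real (d + 1) \<le> real (2 ^ d)" by (rule of_nat_mono)
      then show "real (d + 1) \<le> 2 ^ d" by simp
    qed (use d in auto)
    also have "\<dots> = (32 * real D ^ 4 * K\<^sup>2 * ?T) ^ d"
      by (simp only: power_mult power_mult_distrib[symmetric]) (simp add: power2_eq_square power4_eq_xxxx mult_ac)
    finally show "(\<Sum>\<beta>\<in>{\<beta>\<in>?I - {\<lambda>_. 0}. sum \<beta> ?E = d}. (r \<beta>)\<^sup>2 / mfact ?E \<beta>)
        \<le> (32 * real D ^ 4 * K\<^sup>2 * ?T) ^ d" .
  qed
  finally show ?thesis .
qed

lemma sum_power_le_twice:
  fixes \<tau> :: real
  assumes "0 \<le> \<tau>" "\<tau> \<le> 1 / 2"
  shows "(\<Sum>d\<in>{1..D}. \<tau> ^ d) \<le> 2 * \<tau>"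
proof -
  \<comment> \<open>The deficit \<open>(1 / 2) ^ D\<close> makes the induction go through: the next
    term is at most \<open>\<tau> * (1 / 2) ^ D\<close>, which halves it.\<close>
  have "(\<Sum>d\<in>{1..D}. \<tau> ^ d) \<le> 2 * \<tau> * (1 - (1 / 2) ^ D)"
  proof (induction D)
    case (Suc D)
    have "\<tau> ^ Suc D \<le> \<tau> * (1 / 2) ^ D"
      using assms by (simp add: mult_left_mono power_mono)
    with Suc.IH show ?case by (simp add: algebra_simps)
  qed simp
  also have "\<dots> \<le> 2 * \<tau> * 1" using assms by (intro mult_left_mono) auto
  finally show ?thesis by simp
qed

section \<open>The trace test\<close>

definition trace_stat :: "nat \<Rightarrow> (nat \<times> nat \<Rightarrow> real) \<Rightarrow> real" where
  "trace_stat n y = (\<Sum>i\<in>{1..n}. y (i, i))"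

lemma poly_fun_on_trace_stat: "poly_fun_on (entries n) 1 (trace_stat n)"
  unfolding poly_fun_on_def
proof (intro exI conjI ballI allI)
  let ?u = "\<lambda>i e. of_bool (e = (i, i)) :: nat"
  have inj: "inj_on ?u {1..n}"
  proof (rule inj_onI)
    fix i j assume "?u i = ?u j"
    from fun_cong[OF this, of "(i, i)"] show "i = j" by (simp add: of_bool_def split: if_splits)
  qed
  show "finite (?u ` {1..n})" by simp
  have diag: "i \<in> {1..n} \<Longrightarrow> (i, i) \<in> entries n" for i by (simp add: entries_def)
  show "sum \<alpha> (entries n) \<le> 1" if "\<alpha> \<in> ?u ` {1..n}" for \<alpha>
    using that diag by (auto simp: finite_entries of_bool_def sum.delta)
  fix y :: "nat \<times> nat \<Rightarrow> real"
  have "(\<Prod>e\<in>entries n. y e ^ ?u i e) = y (i, i)" if "i \<in> {1..n}" for i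
  proof -
    have "(\<Prod>e\<in>entries n. y e ^ ?u i e) = (\<Prod>e\<in>entries n. if e = (i, i) then y e else 1)"
      by (intro prod.cong) auto
    then show ?thesis using diag[OF that] by (simp add: finite_entries prod.delta)
  qed
  then show "trace_stat n y = (\<Sum>\<alpha>\<in>?u ` {1..n}. 1 * (\<Prod>e\<in>entries n. y e ^ \<alpha> e))"
    unfolding trace_stat_def by (subst sum.reindex[OF inj]) simp
qed

text \<open>The first Hermite polynomial is the identity, so centred diagonal entries are
  orthonormal Hermite products and their sum has variance \<open>n\<close>. The free centre
  \<open>m\<close> will be the mean over labels as well.\<close>

lemma trace_stat_noisy:
  shows "has_bochner_integral (noisy_entries n lam x \<sigma>) (trace_stat n) (trace_stat n (signal lam x \<sigma>))"
    and "has_bochner_integral (noisy_entries n lam x \<sigma>) (\<lambda>y. (trace_stat n y - m)\<^sup>2)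
      (real n + (trace_stat n (signal lam x \<sigma>) - m)\<^sup>2)"
proof -
  let ?E = "entries n" and ?N = "noisy_entries n lam x \<sigma>" and ?s = "signal lam x \<sigma>"
  let ?u = "\<lambda>i e. of_bool (e = (i, i)) :: nat"
  have u: "?u i \<in> midx ?E 1" "hermite_prod ?E (?u i) y = y (i, i)" if "i \<in> {1..n}" for i y
  proof -
    have d: "(i, i) \<in> ?E" using that by (simp add: entries_def)
    show "?u i \<in> midx ?E 1" using d by (auto simp: midx_def of_bool_def sum.delta finite_entries)
    have "hermite_prod ?E (?u i) y = (\<Prod>e\<in>?E. if e = (i, i) then y e else 1)"
      unfolding hermite_prod_def by (intro prod.cong) auto
    then show "hermite_prod ?E (?u i) y = y (i, i)" using d by (simp add: finite_entries prod.delta)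
  qed
  have z: "(\<lambda>_. 0) \<in> midx ?E 1" by (simp add: midx_def)
  have one: "has_bochner_integral ?N (\<lambda>y. y (i, i) - ?s (i, i)) 0" if i: "i \<in> {1..n}" for i
  proof -
    have "?u i \<noteq> (\<lambda>_. 0)" by (simp add: fun_eq_iff)
    then show ?thesis
      using hermite_prod_orthogonal[OF finite_entries z u(1)[OF i], of ?s] u(2)[OF i]
      by (simp add: noisy_entries_def hermite_prod_zero)
  qed
  have two: "has_bochner_integral ?N (\<lambda>y. (y (i, i) - ?s (i, i)) * (y (j, j) - ?s (j, j))) (if i = j then 1 else 0)"
    if i: "i \<in> {1..n}" and j: "j \<in> {1..n}" for i j
  proof -
    have "?u i = ?u j \<longleftrightarrow> i = j"
      using fun_cong[of "?u i" "?u j" "(i, i)"] by (auto simp: of_bool_def split: if_splits)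
    moreover have "mfact ?E (?u j) = 1" by (intro prod.neutral) auto
    ultimately show ?thesis
      using hermite_prod_orthogonal[OF finite_entries u(1)[OF j] u(1)[OF i], of ?s] u(2)[OF i] u(2)[OF j]
      by (cases "i = j") (simp_all add: noisy_entries_def)
  qed
  let ?t = "trace_stat n ?s"
  have one': "has_bochner_integral ?N (\<lambda>y. trace_stat n y - ?t) 0"
  proof -
    have "has_bochner_integral ?N (\<lambda>y. \<Sum>i\<in>{1..n}. y (i, i) - ?s (i, i)) (\<Sum>i\<in>{1..n}. 0)"
      by (intro has_bochner_integral_sum one)
    then show ?thesis by (simp add: trace_stat_def sum_subtractf)
  qed
  have c: "has_bochner_integral ?N (\<lambda>_. r) r" for r :: real
  proof -
    interpret prob_space ?N by (rule prob_space_noisy_entries)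
    show ?thesis by (simp add: has_bochner_integral_iff prob_space)
  qed
  show "has_bochner_integral ?N (trace_stat n) ?t"
    using has_bochner_integral_add[OF one' c[of ?t]] by simp
  have "has_bochner_integral ?N (\<lambda>y. \<Sum>i\<in>{1..n}. \<Sum>j\<in>{1..n}. (y (i, i) - ?s (i, i)) * (y (j, j) - ?s (j, j)))
      (\<Sum>i\<in>{1..n}. \<Sum>j\<in>{1..n}. if i = j then 1 else 0)"
    by (intro has_bochner_integral_sum two)
  then have two': "has_bochner_integral ?N (\<lambda>y. (trace_stat n y - ?t)\<^sup>2) (real n)"
    by (simp add: trace_stat_def power2_eq_square sum_product[symmetric] sum_subtractf)
  have "has_bochner_integral ?N (\<lambda>y. (trace_stat n y - ?t)\<^sup>2 + 2 * (?t - m) * (trace_stat n y - ?t) + (?t - m)\<^sup>2)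
      (real n + 2 * (?t - m) * 0 + (?t - m)\<^sup>2)"
    by (intro has_bochner_integral_add has_bochner_integral_mult_right two' one' c)
  also have "(\<lambda>y. (trace_stat n y - ?t)\<^sup>2 + 2 * (?t - m) * (trace_stat n y - ?t) + (?t - m)\<^sup>2) = (\<lambda>y. (trace_stat n y - m)\<^sup>2)"
    by (simp add: fun_eq_iff power2_eq_square algebra_simps)
  finally show "has_bochner_integral ?N (\<lambda>y. (trace_stat n y - m)\<^sup>2) (real n + (?t - m)\<^sup>2)" by simp
qed

text \<open>Averaging coordinate \<open>i\<close> alone kills every cross term
  \<open>i \<noteq> j\<close>, because \<open>g\<close> is centred.\<close>

lemma variance_sum_Pi_pmf:
  fixes g :: "'b \<Rightarrow> real"
  assumes A: "finite A" and p: "finite (set_pmf p)" and g: "measure_pmf.expectation p g = 0"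
  shows "measure_pmf.expectation (Pi_pmf A d (\<lambda>_. p)) (\<lambda>\<sigma>. (\<Sum>i\<in>A. g (\<sigma> i))\<^sup>2)
    = real (card A) * measure_pmf.expectation p (\<lambda>s. (g s)\<^sup>2)"
proof -
  let ?L = "Pi_pmf A d (\<lambda>_. p)"
  have int: "integrable (measure_pmf ?L) f" for f :: "_ \<Rightarrow> real"
    by (intro integrable_measure_pmf_finite finite_set_Pi_pmf A p)
  have pair: "measure_pmf.expectation ?L (\<lambda>\<sigma>. g (\<sigma> i) * g (\<sigma> j))
      = (if i = j then measure_pmf.expectation p (\<lambda>s. (g s)\<^sup>2) else 0)" if "i \<in> A" "j \<in> A" for i j
  proof (cases "i = j")
    case True
    then show ?thesis
      by (subst expectation_Pi_pmf_resample[OF A that(1)]) (auto simp: p power2_eq_square)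
  next
    case False
    then show ?thesis
      by (subst expectation_Pi_pmf_resample[OF A that(1)]) (auto simp: p g)
  qed
  have "measure_pmf.expectation ?L (\<lambda>\<sigma>. (\<Sum>i\<in>A. g (\<sigma> i))\<^sup>2)
      = (\<Sum>i\<in>A. \<Sum>j\<in>A. measure_pmf.expectation ?L (\<lambda>\<sigma>. g (\<sigma> i) * g (\<sigma> j)))"
    by (simp add: power2_eq_square sum_product Bochner_Integration.integral_sum int)
  also have "\<dots> = (\<Sum>i\<in>A. \<Sum>j\<in>A. if i = j then measure_pmf.expectation p (\<lambda>s. (g s)\<^sup>2) else 0)"
    by (intro sum.cong refl pair)
  also have "\<dots> = real (card A) * measure_pmf.expectation p (\<lambda>s. (g s)\<^sup>2)"
    using A by simp
  finally show ?thesis .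
qed

text \<open>The trace counts communities: each contributes the same \<open>k * lam\<close> to the
  mean, as its size is inversely proportional to its signal. The variance is \<open>n\<close> from
  the noise plus a label part, in which one further factor \<open>lam / x l \<le> K\<close>
  appears.\<close>

lemma trace_stat_model:
  assumes v: "valid_params n k lam M x" and K: "\<And>l. l \<in> {1..M} \<Longrightarrow> lam / x l \<le> K"
  defines "P \<equiv> gaussian_model n k lam M x"
  shows "integral\<^sup>L P (trace_stat n) = k * lam * real M"
    and "(\<integral>y. (trace_stat n y - k * lam * real M)\<^sup>2 \<partial>P) \<le> real n + k * lam * real M * K"
proof -
  let ?L = "labels n k M x" and ?p = "label_pmf n k M x"
  define g where "g s = (case s of None \<Rightarrow> 0 | Some l \<Rightarrow> lam / x l)" for s
  have n: "1 \<le> n" and x: "\<And>l. l \<in> {1..M} \<Longrightarrow> 0 < x l" and kl: "0 < k" "0 < lam"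
    using v by (auto simp: valid_params_def)
  have tr: "trace_stat n (signal lam x \<sigma>) = (\<Sum>i\<in>{1..n}. g (\<sigma> i))" for \<sigma>
    unfolding trace_stat_def by (intro sum.cong) (auto simp: signal_def g_def split: option.split)
  define \<mu> where "\<mu> = k * lam * real M / real n"
  have Eg: "measure_pmf.expectation ?p g = \<mu>"
  proof -
    have "x l * k / real n * (lam / x l) = k * lam / real n" if "l \<in> {1..M}" for l
      using x[OF that] by simp
    then have "(\<Sum>l\<in>{1..M}. x l * k / real n * (lam / x l)) = (\<Sum>l\<in>{1..M}. k * lam / real n)"
      by (intro sum.cong refl)
    then have "measure_pmf.expectation ?p g = (\<Sum>l\<in>{1..M}. k * lam / real n)"
      unfolding expectation_label[OF v] by (simp add: g_def)
    then show ?thesis by (simp add: \<mu>_def)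
  qed
  have Eg2: "measure_pmf.expectation ?p (\<lambda>s. (g s)\<^sup>2) \<le> \<mu> * K"
  proof -
    have "measure_pmf.expectation ?p (\<lambda>s. (g s)\<^sup>2) = (\<Sum>l\<in>{1..M}. x l * k / real n * (lam / x l)\<^sup>2)"
      unfolding expectation_label[OF v] by (simp add: g_def)
    also have "\<dots> \<le> (\<Sum>l\<in>{1..M}. k * lam / real n * K)"
    proof (rule sum_mono)
      fix l assume l: "l \<in> {1..M}"
      have "x l * k / real n * (lam / x l)\<^sup>2 = k * lam / real n * (lam / x l)"
        using x[OF l] by (simp add: power2_eq_square)
      also have "\<dots> \<le> k * lam / real n * K" using kl by (intro mult_left_mono K[OF l]) auto
      finally show "x l * k / real n * (lam / x l)\<^sup>2 \<le> k * lam / real n * K" .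
    qed
    also have "\<dots> = \<mu> * K" by (simp add: \<mu>_def)
    finally show ?thesis .
  qed
  have fin: "finite (set_pmf ?p)" by (rule finite_set_label_pmf[OF v])
  have Eg0: "measure_pmf.expectation ?p (\<lambda>s. g s - \<mu>) = 0"
    using Eg by (simp add: integrable_measure_pmf_finite[OF fin])
  have sum\<mu>: "(\<Sum>i\<in>{1..n}. g (\<sigma> i)) - k * lam * real M = (\<Sum>i\<in>{1..n}. g (\<sigma> i) - \<mu>)" for \<sigma> :: "nat \<Rightarrow> nat option"
    using n by (simp add: sum_subtractf \<mu>_def)
  have ES: "measure_pmf.expectation ?L (\<lambda>\<sigma>. \<Sum>i\<in>{1..n}. g (\<sigma> i)) = k * lam * real M"
  proof -
    have "measure_pmf.expectation ?L (\<lambda>\<sigma>. g (\<sigma> i)) = \<mu>" if "i \<in> {1..n}" for i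
      unfolding labels_def using fin that by (subst expectation_Pi_pmf_resample[of _ i]) (auto simp: Eg)
    then show ?thesis
      using n by (simp add: Bochner_Integration.integral_sum integrable_labels[OF v] \<mu>_def)
  qed
  have "has_bochner_integral P (trace_stat n)
      (measure_pmf.expectation ?L (\<lambda>\<sigma>. \<integral>y. trace_stat n y \<partial>noisy_entries n lam x \<sigma>))"
    unfolding P_def by (rule has_bochner_integral_gaussian_model[OF v])
      (use trace_stat_noisy(1) has_bochner_integral_iff in blast)
  also have "(\<lambda>\<sigma>. \<integral>y. trace_stat n y \<partial>noisy_entries n lam x \<sigma>) = (\<lambda>\<sigma>. \<Sum>i\<in>{1..n}. g (\<sigma> i))"
    using trace_stat_noisy(1) tr by (metis has_bochner_integral_iff)
  finally show "integral\<^sup>L P (trace_stat n) = k * lam * real M"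
    by (simp only: ES has_bochner_integral_iff)
  let ?h = "\<lambda>y. (trace_stat n y - k * lam * real M)\<^sup>2"
  have "has_bochner_integral P ?h (measure_pmf.expectation ?L (\<lambda>\<sigma>. \<integral>y. ?h y \<partial>noisy_entries n lam x \<sigma>))"
    unfolding P_def by (rule has_bochner_integral_gaussian_model[OF v])
      (use trace_stat_noisy(2) has_bochner_integral_iff in blast)
  also have "(\<lambda>\<sigma>. \<integral>y. ?h y \<partial>noisy_entries n lam x \<sigma>) = (\<lambda>\<sigma>. real n + (\<Sum>i\<in>{1..n}. g (\<sigma> i) - \<mu>)\<^sup>2)"
    using trace_stat_noisy(2)[of n lam x _ "k * lam * real M"] unfolding tr sum\<mu>
    by (auto simp: has_bochner_integral_iff)
  also have "measure_pmf.expectation ?L \<dots> = real n + measure_pmf.expectation ?L (\<lambda>\<sigma>. (\<Sum>i\<in>{1..n}. g (\<sigma> i) - \<mu>)\<^sup>2)"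
    by (simp add: integrable_labels[OF v])
  also have "measure_pmf.expectation ?L (\<lambda>\<sigma>. (\<Sum>i\<in>{1..n}. g (\<sigma> i) - \<mu>)\<^sup>2)
      = real n * measure_pmf.expectation ?p (\<lambda>s. (g s - \<mu>)\<^sup>2)"
    unfolding labels_def by (subst variance_sum_Pi_pmf[OF _ fin Eg0]) auto
  finally have *: "integral\<^sup>L P ?h = real n + real n * measure_pmf.expectation ?p (\<lambda>s. (g s - \<mu>)\<^sup>2)"
    by (simp add: has_bochner_integral_iff)
  have "measure_pmf.expectation ?p (\<lambda>s. (g s - \<mu>)\<^sup>2) = measure_pmf.expectation ?p (\<lambda>s. (g s)\<^sup>2) - \<mu>\<^sup>2"
    using measure_pmf.variance_eq[of ?p g] by (simp add: integrable_measure_pmf_finite[OF fin] Eg)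
  then have "measure_pmf.expectation ?p (\<lambda>s. (g s - \<mu>)\<^sup>2) \<le> \<mu> * K" using Eg2 by (smt (verit) zero_le_power2)
  then have "real n * measure_pmf.expectation ?p (\<lambda>s. (g s - \<mu>)\<^sup>2) \<le> real n * (\<mu> * K)"
    by (intro mult_left_mono) auto
  also have "real n * (\<mu> * K) = k * lam * real M * K" using n by (simp add: \<mu>_def)
  finally show "integral\<^sup>L P ?h \<le> real n + k * lam * real M * K" using * by simp
qed

section \<open>From bounds at fixed size to the asymptotic statement\<close>

lemma signal_strength_le:
  assumes v: "valid_params n k lam M x" and C: "0 < C" "C \<le> real M * (MIN l\<in>{1..M}. x l)"
    and m: "real M \<le> m" and l: "l \<in> {1..M}"
  shows "lam / x l \<le> lam * m / C"
proof -
  have x: "0 < x l" and lam: "0 < lam" using v l by (auto simp: valid_params_def)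
  have "(MIN l\<in>{1..M}. x l) \<le> x l" using l by (intro Min_le) auto
  then have "C \<le> real M * x l" using C(2) by (meson mult_left_mono of_nat_0_le_iff order_trans)
  also have "\<dots> \<le> m * x l" using m x by (intro mult_right_mono) auto
  finally have "lam * C \<le> lam * (m * x l)" using lam by simp
  then show ?thesis using x C(1) by (simp add: field_simps)
qed

lemma variance_le_max_sd_sq:
  "(\<integral>y. (f y - integral\<^sup>L Q f)\<^sup>2 \<partial>Q) \<le> (max_sd P Q f)\<^sup>2"
proof -
  have "0 \<le> max (\<integral>y. (f y - integral\<^sup>L Q f)\<^sup>2 \<partial>Q) (\<integral>y. (f y - integral\<^sup>L P f)\<^sup>2 \<partial>P)"
    by (simp add: max.coboundedI1)
  then show ?thesis unfolding max_sd_def by simp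
qed

theorem theorem2p4:
  fixes k lam :: "nat \<Rightarrow> real" and M M' :: "nat \<Rightarrow> nat" and x x' :: "nat \<Rightarrow> nat \<Rightarrow> real"
    and C :: real and P Q :: "nat \<Rightarrow> (nat \<times> nat \<Rightarrow> real) measure"
    and Mtilde Mhat :: "nat \<Rightarrow> real"
  assumes "\<And>n. n \<ge> 1 \<Longrightarrow> valid_params n (k n) (lam n) (M n) (x n)"
    and "\<And>n. n \<ge> 1 \<Longrightarrow> valid_params n (k n) (lam n) (M' n) (x' n)"
    and "C > 0"
    and "\<And>n. n \<ge> 1 \<Longrightarrow> real (M n) * (MIN l\<in>{1..M n}. x n l) \<ge> C"
    and "\<And>n. n \<ge> 1 \<Longrightarrow> real (M' n) * (MIN l\<in>{1..M' n}. x' n l) \<ge> C"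
  defines "P \<equiv> \<lambda>n. gaussian_model n (k n) (lam n) (M n) (x n)"
    and "Q \<equiv> \<lambda>n. gaussian_model n (k n) (lam n) (M' n) (x' n)"
    and "Mtilde \<equiv> \<lambda>n. \<bar>real (M n) - real (M' n)\<bar>"
    and "Mhat \<equiv> \<lambda>n. real (max (M n) (M' n))"
  shows "(\<forall>D :: nat \<Rightarrow> nat.
            (\<lambda>n. real (D n) ^ 5 * Mhat n ^ 2 * lam n ^ 2 * max (k n ^ 2 / real n) 1) \<in> o(\<lambda>_. 1) \<longrightarrow>
            \<not> (\<exists>f. degree_test D f \<and> weakly_separates f P Q)) \<and>
         ((\<lambda>n. Mtilde n ^ 2 * lam n ^ 2 * k n ^ 2 / real n) \<in> \<omega>(\<lambda>_. 1) \<and>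
          (\<lambda>n. Mtilde n ^ 2 * k n / Mhat n ^ 2) \<in> \<omega>(\<lambda>_. 1) \<longrightarrow>
            (\<exists>f. degree_test (\<lambda>_. 1) f \<and> strongly_separates f P Q))"
proof (intro conjI allI impI notI)
  \<comment> \<open>Balance gives \<open>1 / x l \<le> M / C\<close>; replacing \<open>M\<close> by
    the larger number of communities yields one bound on the signal for both models.\<close>
  define K where "K n = lam n * Mhat n / C" for n
  have K: "lam n / x n l \<le> K n" if "n \<ge> 1" "l \<in> {1..M n}" for n l
    unfolding K_def by (rule signal_strength_le[OF assms(1)[OF that(1)] assms(3) assms(4)[OF that(1)] _ that(2)])
      (simp add: Mhat_def)
  have K': "lam n / x' n l \<le> K n" if "n \<ge> 1" "l \<in> {1..M' n}" for n l
    unfolding K_def by (rule signal_strength_le[OF assms(2)[OF that(1)] assms(3) assms(5)[OF that(1)] _ that(2)])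
      (simp add: Mhat_def)
  {
    fix D :: "nat \<Rightarrow> nat"
    assume small: "(\<lambda>n. real (D n) ^ 5 * Mhat n ^ 2 * lam n ^ 2 * max (k n ^ 2 / real n) 1) \<in> o(\<lambda>_. 1)"
    assume "\<exists>f. degree_test D f \<and> weakly_separates f P Q"
    then obtain f where f: "degree_test D f" "weakly_separates f P Q" by blast
    define a where "a n = real (D n) ^ 5 * Mhat n ^ 2 * lam n ^ 2 * max (k n ^ 2 / real n) 1" for n
    define \<tau> where "\<tau> n = 32 * real (D n) ^ 4 * (K n)\<^sup>2 * max ((k n)\<^sup>2 / real n) 1" for n
    have \<tau>0: "0 \<le> \<tau> n" for n by (simp add: \<tau>_def)
    have \<tau>a: "\<tau> n \<le> 32 / C\<^sup>2 * a n" for n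
    proof -
      \<comment> \<open>The estimate only calls for a fourth power of the degree; for natural
        \<open>D\<close>, including 0, it is dominated by the fifth.\<close>
      have "real (D n) ^ 4 \<le> real (D n) ^ 5" by (cases "D n") (auto intro: power_increasing)
      then have "32 / C\<^sup>2 * real (D n) ^ 4 * ((Mhat n)\<^sup>2 * (lam n)\<^sup>2 * max ((k n)\<^sup>2 / real n) 1)
          \<le> 32 / C\<^sup>2 * real (D n) ^ 5 * ((Mhat n)\<^sup>2 * (lam n)\<^sup>2 * max ((k n)\<^sup>2 / real n) 1)"
        by (intro mult_right_mono mult_left_mono) auto
      then show ?thesis
        by (simp add: \<tau>_def a_def K_def power_mult_distrib power_divide mult_ac)
    qed
    have "a \<longlonglongrightarrow> 0"
      using smalloD_tendsto[OF small] by (simp add: a_def[abs_def])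
    then have "(\<lambda>n. 32 / C\<^sup>2 * a n) \<longlonglongrightarrow> 32 / C\<^sup>2 * 0" by (intro tendsto_mult tendsto_const)
    then have \<tau>lim: "\<tau> \<longlonglongrightarrow> 0"
      by (intro tendsto_sandwich[of "\<lambda>_. 0" \<tau> sequentially "\<lambda>n. 32 / C\<^sup>2 * a n"])
        (use \<tau>0 \<tau>a in auto)
    obtain c where c: "c > 0"
      and ev: "\<forall>\<^sub>F n in sequentially. norm (max_sd (P n) (Q n) (f n)) \<le> c * norm (mean_gap (P n) (Q n) (f n))"
      using f(2) unfolding weakly_separates_def by (blast elim: landau_o.bigE)
    \<comment> \<open>The threshold \<open>1 / 2\<close> is for the geometric sum. The other makes
      \<open>2 * c^2 * \<tau> < 1\<close>, so that weak separation with constant \<open>c\<close>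
      would give a squared gap smaller than itself.\<close>
    have "\<forall>\<^sub>F n in sequentially. \<tau> n < min (1 / 2) (1 / (2 * c\<^sup>2))"
      using c by (intro order_tendstoD(2)[OF \<tau>lim]) auto
    moreover have "\<forall>\<^sub>F n in sequentially. integral\<^sup>L (P n) (f n) \<noteq> integral\<^sup>L (Q n) (f n)"
      using f(2) unfolding weakly_separates_def by blast
    ultimately have "\<forall>\<^sub>F n in sequentially. False"
      using ev eventually_ge_at_top[of 1]
    proof eventually_elim
      case (elim n)
      let ?g = "mean_gap (P n) (Q n) (f n)" and ?s = "max_sd (P n) (Q n) (f n)"
      note P = assms(1)[OF elim(4)] and Q = assms(2)[OF elim(4)]
      have g: "0 < ?g" using elim(2) by (simp add: mean_gap_def)
      have "?g\<^sup>2 \<le> (\<Sum>\<beta>\<in>midx (entries n) (D n) - {\<lambda>_. 0}.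
          (deconv (entries n) (signal_moment n (k n) (lam n) (M n) (x n)) (signal_moment n (k n) (lam n) (M' n) (x' n)) \<beta>)\<^sup>2
            / mfact (entries n) \<beta>) * (\<integral>y. (f n y - integral\<^sup>L (Q n) (f n))\<^sup>2 \<partial>Q n)"
        unfolding P_def Q_def using f(1) by (intro mean_gap_sq_le[OF P Q]) (simp add: degree_test_def)
      also have "\<dots> \<le> (2 * \<tau> n) * ?s\<^sup>2"
      proof (rule mult_mono[OF _ variance_le_max_sd_sq])
        show "(\<Sum>\<beta>\<in>midx (entries n) (D n) - {\<lambda>_. 0}.
          (deconv (entries n) (signal_moment n (k n) (lam n) (M n) (x n)) (signal_moment n (k n) (lam n) (M' n) (x' n)) \<beta>)\<^sup>2
            / mfact (entries n) \<beta>) \<le> 2 * \<tau> n"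
          using sum_deconv_sq_le[OF P Q K[OF elim(4)] K'[OF elim(4)], where D = "D n"] sum_power_le_twice[OF \<tau>0[of n], where D = "D n"] elim(1,4)
          unfolding \<tau>_def by linarith
      qed (use \<tau>0 in auto)
      also have "\<dots> \<le> (2 * \<tau> n) * (c * ?g)\<^sup>2"
      proof (rule mult_left_mono)
        have "\<bar>?s\<bar> \<le> c * ?g" using elim(3) g by simp
        then show "?s\<^sup>2 \<le> (c * ?g)\<^sup>2" using power_mono[of "\<bar>?s\<bar>" "c * ?g" 2] by simp
      qed (use \<tau>0 in simp)
      also have "\<dots> = (2 * c\<^sup>2 * \<tau> n) * ?g\<^sup>2" by (simp add: power_mult_distrib)
      also have "\<dots> < 1 * ?g\<^sup>2"
        using elim(1) c g by (intro mult_strict_right_mono) (auto simp: field_simps)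
      finally show False by simp
    qed
    then show False by simp
  }
  {
    assume big: "(\<lambda>n. Mtilde n ^ 2 * lam n ^ 2 * k n ^ 2 / real n) \<in> \<omega>(\<lambda>_. 1) \<and>
          (\<lambda>n. Mtilde n ^ 2 * k n / Mhat n ^ 2) \<in> \<omega>(\<lambda>_. 1)"
    have gap: "mean_gap (P n) (Q n) (trace_stat n) = k n * lam n * Mtilde n"
      and sd: "(max_sd (P n) (Q n) (trace_stat n))\<^sup>2 \<le> real n + k n * (lam n * Mhat n)\<^sup>2 / C" if n: "n \<ge> 1" for n
    proof -
      note P = assms(1)[OF n] and Q = assms(2)[OF n]
      have pos: "0 < k n" "0 < lam n" using P by (auto simp: valid_params_def)
      have tP: "integral\<^sup>L (P n) (trace_stat n) = k n * lam n * real (M n)"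
        "(\<integral>y. (trace_stat n y - k n * lam n * real (M n))\<^sup>2 \<partial>P n) \<le> real n + k n * lam n * real (M n) * K n"
        unfolding P_def by (rule trace_stat_model[OF P K[OF n]]; assumption)+
      have tQ: "integral\<^sup>L (Q n) (trace_stat n) = k n * lam n * real (M' n)"
        "(\<integral>y. (trace_stat n y - k n * lam n * real (M' n))\<^sup>2 \<partial>Q n) \<le> real n + k n * lam n * real (M' n) * K n"
        unfolding Q_def by (rule trace_stat_model[OF Q K'[OF n]]; assumption)+
      show "mean_gap (P n) (Q n) (trace_stat n) = k n * lam n * Mtilde n"
        using pos unfolding mean_gap_def Mtilde_def tP(1) tQ(1)
        by (simp add: right_diff_distrib[symmetric] abs_mult)
      have K0: "0 \<le> K n" using pos assms(3) by (simp add: K_def Mhat_def)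
      have "k n * lam n * real (M n) * K n \<le> k n * lam n * Mhat n * K n"
        "k n * lam n * real (M' n) * K n \<le> k n * lam n * Mhat n * K n"
        using pos K0 by (auto simp: Mhat_def intro!: mult_right_mono mult_left_mono)
      moreover have "k n * lam n * Mhat n * K n = k n * (lam n * Mhat n)\<^sup>2 / C"
        by (simp add: K_def power2_eq_square)
      moreover have "0 \<le> max (\<integral>y. (trace_stat n y - integral\<^sup>L (Q n) (trace_stat n))\<^sup>2 \<partial>Q n)
          (\<integral>y. (trace_stat n y - integral\<^sup>L (P n) (trace_stat n))\<^sup>2 \<partial>P n)"
        by (simp add: max.coboundedI1)
      ultimately show "(max_sd (P n) (Q n) (trace_stat n))\<^sup>2 \<le> real n + k n * (lam n * Mhat n)\<^sup>2 / C"
        using tP(2) tQ(2) unfolding max_sd_def tP(1) tQ(1) by simp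
    qed
    \<comment> \<open>The two growth assumptions control the two variance contributions: the first
      the noise term \<open>n\<close>, the second the fluctuation of the labels. Each is made at
      most half of \<open>c^2\<close> times the squared gap.\<close>
    have ev: "\<forall>\<^sub>F n in sequentially. 0 < mean_gap (P n) (Q n) (trace_stat n) \<and>
        max_sd (P n) (Q n) (trace_stat n) \<le> c * mean_gap (P n) (Q n) (trace_stat n)" if c: "c > 0" for c
    proof -
      have "\<forall>\<^sub>F n in sequentially. norm (Mtilde n ^ 2 * lam n ^ 2 * k n ^ 2 / real n) \<ge> 2 / c\<^sup>2 * norm (1::real)"
        using c big by (intro landau_omega.smallD[of _ _ "\<lambda>_. 1"]) auto
      moreover have "\<forall>\<^sub>F n in sequentially. norm (Mtilde n ^ 2 * k n / Mhat n ^ 2) \<ge> 2 / (C * c\<^sup>2) * norm (1::real)"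
        using c big assms(3) by (intro landau_omega.smallD[of _ _ "\<lambda>_. 1"]) auto
      ultimately show ?thesis
        using eventually_ge_at_top[of 1]
      proof eventually_elim
        case (elim n)
        have pos: "0 < k n" "0 < lam n" "0 < Mhat n" "0 < real n"
          using assms(1)[OF elim(3)] elim(3) by (auto simp: valid_params_def Mhat_def)
        let ?g = "k n * lam n * Mtilde n"
        have A: "2 / c\<^sup>2 \<le> ?g\<^sup>2 / real n" using elim(1) pos by (simp add: power_mult_distrib mult_ac)
        have B: "2 / (C * c\<^sup>2) \<le> Mtilde n ^ 2 * k n / Mhat n ^ 2" using elim(2) pos by simp
        have "0 < 2 / c\<^sup>2" using c by simp
        with A have "?g \<noteq> 0" using pos by auto
        moreover have "0 \<le> ?g" using pos by (simp add: Mtilde_def)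
        ultimately have g: "0 < ?g" by linarith
        have 1: "real n \<le> c\<^sup>2 / 2 * ?g\<^sup>2" using A c pos by (simp add: field_simps)
        have "2 * (Mhat n)\<^sup>2 \<le> C * c\<^sup>2 * ((Mtilde n)\<^sup>2 * k n)" using B c pos assms(3) by (simp add: field_simps)
        then have "k n * (lam n)\<^sup>2 * (2 * (Mhat n)\<^sup>2) \<le> k n * (lam n)\<^sup>2 * (C * c\<^sup>2 * ((Mtilde n)\<^sup>2 * k n))"
          using pos by (intro mult_left_mono) auto
        then have 2: "k n * (lam n * Mhat n)\<^sup>2 / C \<le> c\<^sup>2 / 2 * ?g\<^sup>2"
          using assms(3) by (simp add: field_simps power2_eq_square)
        have "(max_sd (P n) (Q n) (trace_stat n))\<^sup>2 \<le> (c * ?g)\<^sup>2"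
          unfolding power_mult_distrib[of c ?g] using sd[OF elim(3)] 1 2 by linarith
        then have "max_sd (P n) (Q n) (trace_stat n) \<le> c * ?g"
          by (rule power2_le_imp_le) (use c g in simp)
        with g show ?case by (simp add: gap[OF elim(3)])
      qed
    qed
    have "strongly_separates trace_stat P Q"
      unfolding strongly_separates_def
    proof (intro conjI landau_o.smallI)
      show "\<forall>\<^sub>F n in sequentially. integral\<^sup>L (P n) (trace_stat n) \<noteq> integral\<^sup>L (Q n) (trace_stat n)"
        using ev[OF zero_less_one] by eventually_elim (auto simp: mean_gap_def)
      fix c :: real assume "c > 0"
      from ev[OF this] show "\<forall>\<^sub>F n in sequentially. norm (max_sd (P n) (Q n) (trace_stat n))
          \<le> c * norm (mean_gap (P n) (Q n) (trace_stat n))"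
      proof eventually_elim
        case (elim n)
        moreover have "0 \<le> max_sd (P n) (Q n) (trace_stat n)"
          unfolding max_sd_def by (simp add: max.coboundedI1)
        ultimately show ?case by simp
      qed
    qed
    then show "\<exists>f. degree_test (\<lambda>_. 1) f \<and> strongly_separates f P Q"
      using poly_fun_on_trace_stat by (auto simp: degree_test_def)
  }
qed

end
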